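(* Let $X$ be a quasi-semicategory and let $s_0\colon X_0\to X_1$ be any function such that for each $x\in X_0$, $s_0(x)$ is an idempotent equivalence $x\to x$. Then $X$ has a simplicial structure whose degeneracy $X_0\to X_1$ in degree $0$ coincides with $s_0$.
   Context: Let $\Delta^{\mathrm{inj}}$ be the category of the totally ordered finite sets $[n]=\{0,\dots,n\}$, $n\ge 0$, and strictly monotone maps. A semisimplicial set is a functor $X\colon(\Delta^{\mathrm{inj}})^{op}\to \mathrm{Set}$; thus it has sets $X_n$ and face maps $d_i\colon X_n\to X_{n-1}$ ($0\le i\le n$), but no degeneracies. $\Delta^n$ denotes the semisimplicial $n$-simplex (the presheaf represented by $[n]$), and $\Lambda^n_i\subset\Delta^n$ the $(n,i)$-horn (the union of all codimension-one faces of $\Delta^n$ except the $i$-th one). A quasi-semicategory is a semisimplicial set $X$ in which all inner horns can be filled: every semisimplicial map $\Lambda^n_i\to X$ with $0<i<n$ extends to a semisimplicial map $\Delta^n\to X$. For $f\in X_1$ write $f\colon x\to y$ where $x=d_1f$ and $y=d_0f$. For $f,g,h\in X_1$ write $g\circ f\simeq h$ if there is $\sigma\in X_2$ with $d_1\sigma=h$, $d_2\sigma=f$ and $d_0\sigma=g$. An $f\colon x\to x$ is called idempotent if $f\circ f\simeq f$. An element $f\in X_1$ is called an equivalence if for every $n\ge 2$ there is a filler (an extension to $\Delta^n$) for every horn $\Lambda^n_n\to X$ whose last edge (the edge $\{n-1,n\}$) is $f$, and for every horn $\Lambda^n_0\to X$ whose first edge (the edge $\{0,1\}$) is $f$. A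 quasi-semicategory $X$ has a simplicial structure if it is the underlying semisimplicial set of a simplicial set (i.e. there are degeneracy maps which, together with the given face maps, make $X$ a simplicial set). *)

theory Defs
  imports Main "HOL-Library.FuncSet"
begin

text \<open>
  The object \<open>[n]\<close> is the natural number \<open>n\<close>. A map \<open>[m] \<rightarrow> [n]\<close> is a function on \<open>{0..m}\<close>
  that is extensional, so that equality of maps is equality in HOL.
\<close>

definition delta_maps :: "nat \<Rightarrow> nat \<Rightarrow> (nat \<Rightarrow> nat) set" where
  "delta_maps m n = {\<alpha> \<in> {0..m} \<rightarrow>\<^sub>E {0..n}. mono_on {0..m} \<alpha>}"

definition delta_inj_maps :: "nat \<Rightarrow> nat \<Rightarrow> (nat \<Rightarrow> nat) set" where
  "delta_inj_maps m n = {\<alpha> \<in> {0..m} \<rightarrow>\<^sub>E {0..n}. strict_mono_on {0..m} \<alpha>}"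

definition delta_id :: "nat \<Rightarrow> nat \<Rightarrow> nat" where
  "delta_id n = restrict (\<lambda>k. k) {0..n}"

text \<open>The composite of \<open>\<alpha>: [k] \<rightarrow> [m]\<close> and \<open>\<beta>: [m] \<rightarrow> [n]\<close>.\<close>

definition delta_comp :: "nat \<Rightarrow> (nat \<Rightarrow> nat) \<Rightarrow> (nat \<Rightarrow> nat) \<Rightarrow> nat \<Rightarrow> nat" where
  "delta_comp k \<beta> \<alpha> = compose {0..k} \<beta> \<alpha>"

text \<open>The map \<open>[n-1] \<rightarrow> [n]\<close> whose image omits \<open>i\<close>; meaningful for \<open>n \<ge> 1\<close> and \<open>i \<le> n\<close>.\<close>

definition coface :: "nat \<Rightarrow> nat \<Rightarrow> nat \<Rightarrow> nat" where
  "coface n i = restrict (\<lambda>k. if k < i then k else k + 1) {0..n - 1}"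

text \<open>The map \<open>[n+1] \<rightarrow> [n]\<close> that takes the value \<open>i\<close> twice.\<close>

definition codegeneracy :: "nat \<Rightarrow> nat \<Rightarrow> nat \<Rightarrow> nat" where
  "codegeneracy n i = restrict (\<lambda>k. if k \<le> i then k else k - 1) {0..n + 1}"

text \<open>
  Data of a presheaf: \<open>act X m n \<alpha>\<close> is the map \<open>X\<^sub>n \<rightarrow> X\<^sub>m\<close> induced by \<open>\<alpha>: [m] \<rightarrow> [n]\<close>; its values
  outside \<open>cells X n\<close>, or for \<open>\<alpha>\<close> outside the indexing category, carry no information.
\<close>

record 'a presheaf =
  cells :: "nat \<Rightarrow> 'a set"
  act :: "nat \<Rightarrow> nat \<Rightarrow> (nat \<Rightarrow> nat) \<Rightarrow> 'a \<Rightarrow> 'a"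

definition presheaf_on :: "(nat \<Rightarrow> nat \<Rightarrow> (nat \<Rightarrow> nat) set) \<Rightarrow> 'a presheaf \<Rightarrow> bool" where
  "presheaf_on hom X \<longleftrightarrow>
     (\<forall>m n. \<forall>\<alpha>\<in>hom m n. \<forall>x\<in>cells X n. act X m n \<alpha> x \<in> cells X m) \<and>
     (\<forall>n. \<forall>x\<in>cells X n. act X n n (delta_id n) x = x) \<and>
     (\<forall>k m n. \<forall>\<alpha>\<in>hom k m. \<forall>\<beta>\<in>hom m n. \<forall>x\<in>cells X n.
        act X k n (delta_comp k \<beta> \<alpha>) x = act X k m \<alpha> (act X m n \<beta> x))"

definition semisimplicial_set :: "'a presheaf \<Rightarrow> bool" where
  "semisimplicial_set X \<longleftrightarrow> presheaf_on delta_inj_maps X"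

definition simplicial_set :: "'a presheaf \<Rightarrow> bool" where
  "simplicial_set X \<longleftrightarrow> presheaf_on delta_maps X"

definition semisimplicial_map ::
    "'a presheaf \<Rightarrow> 'b presheaf \<Rightarrow> (nat \<Rightarrow> 'a \<Rightarrow> 'b) \<Rightarrow> bool" where
  "semisimplicial_map X Y \<phi> \<longleftrightarrow>
     (\<forall>n. \<forall>x\<in>cells X n. \<phi> n x \<in> cells Y n) \<and>
     (\<forall>m n. \<forall>\<alpha>\<in>delta_inj_maps m n. \<forall>x\<in>cells X n. \<phi> m (act X m n \<alpha> x) = act Y m n \<alpha> (\<phi> n x))"

definition face :: "'a presheaf \<Rightarrow> nat \<Rightarrow> nat \<Rightarrow> 'a \<Rightarrow> 'a" where
  "face X n i = act X (n - 1) n (coface n i)"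

definition degeneracy :: "'a presheaf \<Rightarrow> nat \<Rightarrow> nat \<Rightarrow> 'a \<Rightarrow> 'a" where
  "degeneracy X n i = act X (n + 1) n (codegeneracy n i)"

definition std_simplex :: "nat \<Rightarrow> (nat \<Rightarrow> nat) presheaf" where
  "std_simplex n =
     \<lparr>cells = (\<lambda>m. delta_inj_maps m n), act = (\<lambda>k m \<alpha> \<gamma>. delta_comp k \<gamma> \<alpha>)\<rparr>"

text \<open>The \<open>m\<close>-cells of the \<open>j\<close>-th codimension-one face: the image of \<open>\<Delta>\<^bsup>n-1\<^esup> \<rightarrow> \<Delta>\<^sup>n\<close> induced by the
  \<open>j\<close>-th coface.\<close>

definition simplex_face_cells :: "nat \<Rightarrow> nat \<Rightarrow> nat \<Rightarrow> (nat \<Rightarrow> nat) set" where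
  "simplex_face_cells n j m = delta_comp m (coface n j) ` delta_inj_maps m (n - 1)"

definition horn :: "nat \<Rightarrow> nat \<Rightarrow> (nat \<Rightarrow> nat) presheaf" where
  "horn n i =
     \<lparr>cells = (\<lambda>m. \<Union>j\<in>{0..n} - {i}. simplex_face_cells n j m), act = act (std_simplex n)\<rparr>"

definition has_filler :: "'a presheaf \<Rightarrow> nat \<Rightarrow> nat \<Rightarrow> (nat \<Rightarrow> (nat \<Rightarrow> nat) \<Rightarrow> 'a) \<Rightarrow> bool" where
  "has_filler X n i \<phi> \<longleftrightarrow>
     (\<exists>\<psi>. semisimplicial_map (std_simplex n) X \<psi> \<and>
          (\<forall>m. \<forall>\<gamma>\<in>cells (horn n i) m. \<psi> m \<gamma> = \<phi> m \<gamma>))"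

definition quasi_semicategory :: "'a presheaf \<Rightarrow> bool" where
  "quasi_semicategory X \<longleftrightarrow>
     semisimplicial_set X \<and>
     (\<forall>n i \<phi>. 0 < i \<and> i < n \<and> semisimplicial_map (horn n i) X \<phi> \<longrightarrow> has_filler X n i \<phi>)"

definition arrow :: "'a presheaf \<Rightarrow> 'a \<Rightarrow> 'a \<Rightarrow> 'a \<Rightarrow> bool" where
  "arrow X f x y \<longleftrightarrow> f \<in> cells X 1 \<and> face X 1 1 f = x \<and> face X 1 0 f = y"

text \<open>\<open>composes_to X g f h\<close> is the relation \<open>g \<circ> f \<simeq> h\<close>.\<close>

definition composes_to :: "'a presheaf \<Rightarrow> 'a \<Rightarrow> 'a \<Rightarrow> 'a \<Rightarrow> bool" where
  "composes_to X g f h \<longleftrightarrow>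
     (\<exists>\<sigma>\<in>cells X 2. face X 2 1 \<sigma> = h \<and> face X 2 2 \<sigma> = f \<and> face X 2 0 \<sigma> = g)"

definition idempotent_at :: "'a presheaf \<Rightarrow> 'a \<Rightarrow> 'a \<Rightarrow> bool" where
  "idempotent_at X x f \<longleftrightarrow> arrow X f x x \<and> composes_to X f f f"

text \<open>The edge \<open>{a,b}\<close> (with \<open>a < b\<close>) of a simplex, as a map \<open>[1] \<rightarrow> [n]\<close>.\<close>

definition edge :: "nat \<Rightarrow> nat \<Rightarrow> nat \<Rightarrow> nat" where
  "edge a b = restrict (\<lambda>k. if k = 0 then a else b) {0..1}"

definition equivalence :: "'a presheaf \<Rightarrow> 'a \<Rightarrow> bool" where
  "equivalence X f \<longleftrightarrow>
     f \<in> cells X 1 \<and>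
     (\<forall>n\<ge>2.
        (\<forall>\<phi>. semisimplicial_map (horn n n) X \<phi> \<and> \<phi> 1 (edge (n - 1) n) = f \<longrightarrow> has_filler X n n \<phi>) \<and>
        (\<forall>\<phi>. semisimplicial_map (horn n 0) X \<phi> \<and> \<phi> 1 (edge 0 1) = f \<longrightarrow> has_filler X n 0 \<phi>))"

text \<open>
  \<open>Y\<close> is a simplicial set whose underlying semisimplicial set is \<open>X\<close>. The two actions are compared
  only where they are meaningful.
\<close>

definition simplicial_structure_on :: "'a presheaf \<Rightarrow> 'a presheaf \<Rightarrow> bool" where
  "simplicial_structure_on X Y \<longleftrightarrow>
     simplicial_set Y \<and> cells Y = cells X \<and>
     (\<forall>m n. \<forall>\<alpha>\<in>delta_inj_maps m n. \<forall>x\<in>cells X n. act Y m n \<alpha> x = act X m n \<alpha> x)"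

end

theory Submission
  imports Defs
begin

text \<open>
  Write a monotone map \<open>\<tau>: [n] \<rightarrow> [m]\<close> as the weakly increasing word \<open>\<tau>(0) \<dots> \<tau>(n)\<close> in the letters
  \<open>0, \<dots>, m\<close>; precomposing with the \<open>i\<close>-th coface omits the \<open>i\<close>-th letter. A simplicial structure on
  \<open>X\<close> gives for every \<open>m\<close>-cell \<open>x\<close> and every such word a cell \<open>\<tau>\<^sup>*x\<close>, in a way that is compatible with
  composition and with the faces of \<open>X\<close>. It is built by induction on the dimension \<open>m\<close> of \<open>x\<close>.

  If a word misses the letter \<open>j\<close>, then \<open>\<tau>\<^sup>*x\<close> is forced to be the corresponding value on \<open>d\<^sub>j x\<close>; the
  choice of \<open>j\<close> does not matter (\<open>lower_faces_agree\<close>). If \<open>x\<close> is already of the form \<open>\<sigma>\<^sup>*z\<close> with \<open>z\<close> of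
  lower dimension, then everything is forced by \<open>\<rho>\<^sup>*x = (\<sigma>\<rho>)\<^sup>*z\<close>; different presentations of \<open>x\<close> give
  the same result, by the argument of the Eilenberg--Zilber lemma (\<open>presentations_agree\<close>). It remains
  to treat a nondegenerate \<open>m\<close>-cell: a face-compatible family of cells, given on the words that miss a
  letter and on \<open>01\<dots>m\<close>, has to be extended to all weakly increasing words.

  This is done by filling horns, but not directly: a word with a letter \<open>j\<close> that is repeated has
  several equal faces, and a horn lacks only one face. The remedy is to adjoin to every vertex \<open>j\<close> a
  copy \<open>j'\<close>, placed after \<open>j\<close>, which is used at most once in a word and for which the edge \<open>jj'\<close> is
  the given self-equivalence of the vertex \<open>j\<close>. Consider the words \<open>u j\<^sup>a j' v\<close> where \<open>a \<ge> 1\<close>, the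
  letters of \<open>u\<close> are exactly those below \<open>j\<close>, with any multiplicities, and \<open>v = (j+1)\<dots>m\<close>. For \<open>a \<ge> 2\<close>
  the face \<open>u j\<^sup>a v\<close> occurs exactly once; if all other faces are known, a horn filler yields cells for
  both \<open>u j\<^sup>a j' v\<close> and \<open>u j\<^sup>a v\<close>. For \<open>a = 1\<close> the face \<open>u j v\<close> is already known and the filler
  yields \<open>u j j' v\<close> together with \<open>u j' v\<close>. If the words are treated by increasing length, and by
  increasing \<open>j\<close> for equal length, then all other faces have been treated before. If \<open>m \<ge> 1\<close>, the horn
  is inner except in two cases: the missing face is the \<open>0\<close>-th one, and then the first edge is \<open>00'\<close>, or
  it is the last one, and then the last edge is \<open>mm'\<close>. In both cases that edge is an equivalence. Every
  weakly increasing word containing all letters is either \<open>01\<dots>m\<close> or of the form \<open>u j\<^sup>a v\<close> with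
  \<open>a \<ge> 2\<close>, so all of them are reached (\<open>extend_over_simplex\<close>).

  For \<open>m = 0\<close> the words are \<open>0\<dots>0\<close>. Both \<open>00\<close> and \<open>00'\<close> are the prescribed edge, \<open>000'\<close> is the cell
  that witnesses its idempotency, and the words \<open>0\<^sup>a 0'\<close> with \<open>a \<ge> 3\<close> produce the words \<open>0\<^sup>a\<close> one after
  the other (\<open>extend_over_vertex\<close>).
\<close>

section \<open>Monotone maps\<close>

lemma delta_inj_maps_iff: "\<alpha> \<in> delta_inj_maps m n \<longleftrightarrow> \<alpha> \<in> delta_maps m n \<and> inj_on \<alpha> {0..m}"
proof
  assume *: "\<alpha> \<in> delta_inj_maps m n"
  then have sm: "strict_mono_on {0..m} \<alpha>" by (simp add: delta_inj_maps_def)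
  have "mono_on {0..m} \<alpha>" "inj_on \<alpha> {0..m}"
    by (rule strict_mono_on_imp_mono_on[OF sm], rule strict_mono_on_imp_inj_on[OF sm])
  with * show "\<alpha> \<in> delta_maps m n \<and> inj_on \<alpha> {0..m}"
    by (simp add: delta_inj_maps_def delta_maps_def)
next
  assume *: "\<alpha> \<in> delta_maps m n \<and> inj_on \<alpha> {0..m}"
  have "strict_mono_on {0..m} \<alpha>"
  proof (rule strict_mono_onI)
    fix r s assume rs: "r \<in> {0..m}" "s \<in> {0..m}" "r < s"
    then have "\<alpha> r \<le> \<alpha> s" using * by (auto simp: delta_maps_def intro: mono_onD)
    moreover have "\<alpha> r \<noteq> \<alpha> s" using * rs by (auto dest: inj_onD)
    ultimately show "\<alpha> r < \<alpha> s" by simp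
  qed
  with * show "\<alpha> \<in> delta_inj_maps m n"
    by (simp add: delta_inj_maps_def delta_maps_def)
qed

lemma delta_inj_mapsD: "\<alpha> \<in> delta_inj_maps m n \<Longrightarrow> \<alpha> \<in> delta_maps m n"
  by (simp add: delta_inj_maps_iff)

lemma delta_maps_le: "\<alpha> \<in> delta_maps m n \<Longrightarrow> i \<le> m \<Longrightarrow> \<alpha> i \<le> n"
  by (auto simp: delta_maps_def PiE_iff)

lemma delta_maps_mono: "\<alpha> \<in> delta_maps m n \<Longrightarrow> i \<le> j \<Longrightarrow> j \<le> m \<Longrightarrow> \<alpha> i \<le> \<alpha> j"
  by (auto simp: delta_maps_def mono_on_def)

lemma delta_maps_eqI:
  assumes "\<alpha> \<in> delta_maps m n" "\<beta> \<in> delta_maps m n'" "\<And>i. i \<le> m \<Longrightarrow> \<alpha> i = \<beta> i"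
  shows "\<alpha> = \<beta>"
  using assms by (intro extensionalityI[of _ "{0..m}"]) (auto simp: delta_maps_def PiE_iff)

lemma restrict_in_delta_maps:
  "(\<And>i. i \<le> m \<Longrightarrow> f i \<le> n) \<Longrightarrow> (\<And>i j. i \<le> j \<Longrightarrow> j \<le> m \<Longrightarrow> f i \<le> f j)
    \<Longrightarrow> restrict f {0..m} \<in> delta_maps m n"
  by (auto simp: delta_maps_def mono_on_def PiE_iff)

lemma delta_id_in: "delta_id n \<in> delta_inj_maps n n"
  unfolding delta_inj_maps_iff delta_id_def by (auto intro!: restrict_in_delta_maps simp: inj_on_def)

lemma delta_id_apply [simp]: "i \<le> n \<Longrightarrow> delta_id n i = i"
  by (simp add: delta_id_def)

lemma delta_comp_apply [simp]: "i \<le> k \<Longrightarrow> delta_comp k \<beta> \<alpha> i = \<beta> (\<alpha> i)"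
  by (simp add: delta_comp_def compose_def)

lemma delta_comp_in:
  "\<alpha> \<in> delta_maps k m \<Longrightarrow> \<beta> \<in> delta_maps m n \<Longrightarrow> delta_comp k \<beta> \<alpha> \<in> delta_maps k n"
  unfolding delta_comp_def compose_def
  by (intro restrict_in_delta_maps) (auto intro: delta_maps_le delta_maps_mono)

lemma delta_inj_maps_eq_iff:
  "\<alpha> \<in> delta_inj_maps m n \<Longrightarrow> i \<le> m \<Longrightarrow> j \<le> m \<Longrightarrow> \<alpha> i = \<alpha> j \<longleftrightarrow> i = j"
  by (auto simp: delta_inj_maps_iff dest: inj_onD)

lemma delta_comp_in_inj:
  assumes \<alpha>: "\<alpha> \<in> delta_inj_maps k m" and \<beta>: "\<beta> \<in> delta_inj_maps m n"
  shows "delta_comp k \<beta> \<alpha> \<in> delta_inj_maps k n"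
proof -
  have "inj_on (delta_comp k \<beta> \<alpha>) {0..k}"
    by (rule inj_onI)
      (simp add: delta_inj_maps_eq_iff[OF \<alpha>] delta_inj_maps_eq_iff[OF \<beta>]
        delta_maps_le[OF delta_inj_mapsD[OF \<alpha>]])
  then show ?thesis
    using delta_comp_in[OF delta_inj_mapsD[OF \<alpha>] delta_inj_mapsD[OF \<beta>]]
    by (simp add: delta_inj_maps_iff)
qed

lemma delta_comp_inj_right:
  assumes \<gamma>: "delta_comp k \<beta> \<alpha> \<in> delta_inj_maps k n" and \<alpha>: "\<alpha> \<in> delta_maps k m"
  shows "\<alpha> \<in> delta_inj_maps k m"
proof -
  have "inj_on \<alpha> {0..k}"
  proof (rule inj_onI)
    fix i j assume "i \<in> {0..k}" "j \<in> {0..k}" "\<alpha> i = \<alpha> j"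
    then show "i = j" using delta_inj_maps_eq_iff[OF \<gamma>, of i j] by simp
  qed
  with \<alpha> show ?thesis by (simp add: delta_inj_maps_iff)
qed

lemma delta_comp_assoc:
  "\<alpha> \<in> delta_maps k l \<Longrightarrow> delta_comp k \<gamma> (delta_comp k \<beta> \<alpha>) = delta_comp k (delta_comp l \<gamma> \<beta>) \<alpha>"
  by (auto simp: delta_comp_def compose_def restrict_def fun_eq_iff dest: delta_maps_le)

lemma delta_comp_id_left [simp]: "\<alpha> \<in> delta_maps k n \<Longrightarrow> delta_comp k (delta_id n) \<alpha> = \<alpha>"
  by (rule delta_maps_eqI[OF delta_comp_in[OF _ delta_inj_mapsD[OF delta_id_in]]])
    (auto simp: delta_maps_le)

lemma delta_comp_id_right [simp]: "\<alpha> \<in> delta_maps k n \<Longrightarrow> delta_comp k \<alpha> (delta_id k) = \<alpha>"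
  by (rule delta_maps_eqI[OF delta_comp_in[OF delta_inj_mapsD[OF delta_id_in]]]) auto

lemma coface_apply: "i \<le> n - 1 \<Longrightarrow> coface n j i = (if i < j then i else i + 1)"
  by (simp add: coface_def)

lemma coface_in: "1 \<le> n \<Longrightarrow> j \<le> n \<Longrightarrow> coface n j \<in> delta_inj_maps (n - 1) n"
  unfolding delta_inj_maps_iff coface_def by (auto intro!: restrict_in_delta_maps simp: inj_on_def)

lemma coface_in_maps: "1 \<le> n \<Longrightarrow> j \<le> n \<Longrightarrow> coface n j \<in> delta_maps (n - 1) n"
  by (intro delta_inj_mapsD coface_in)

lemma coface_coface:
  assumes "i < j" "j \<le> n" "2 \<le> n"
  shows "delta_comp (n - 2) (coface n j) (coface (n - 1) i)
       = delta_comp (n - 2) (coface n i) (coface (n - 1) (j - 1))"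
proof (rule delta_maps_eqI[of _ "n-2" n _ n])
  have "coface (n - 1) k \<in> delta_maps (n - 2) (n - 1)" if "k \<le> n - 1" for k
    using coface_in_maps[of "n-1" k] that assms by (simp add: numeral_2_eq_2)
  then show "delta_comp (n - 2) (coface n j) (coface (n - 1) i) \<in> delta_maps (n - 2) n"
    "delta_comp (n - 2) (coface n i) (coface (n - 1) (j - 1)) \<in> delta_maps (n - 2) n"
    using assms by (auto intro!: delta_comp_in coface_in_maps)
qed (use assms in \<open>auto simp: coface_apply\<close>)

lemma factor_through_coface:
  assumes "\<alpha> \<in> delta_maps m n" "j \<le> n" "j \<notin> \<alpha> ` {0..m}"
  obtains \<beta> where "1 \<le> n" "\<beta> \<in> delta_maps m (n - 1)" "\<alpha> = delta_comp m (coface n j) \<beta>"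
proof -
  define \<beta> where "\<beta> = restrict (\<lambda>i. if \<alpha> i < j then \<alpha> i else \<alpha> i - 1) {0..m}"
  have ne: "\<alpha> i \<noteq> j" if "i \<le> m" for i using assms(3) that by auto
  have n: "1 \<le> n" using ne[of 0] delta_maps_le[OF assms(1), of 0] assms(2) by auto
  have \<beta>: "\<beta> \<in> delta_maps m (n - 1)"
    unfolding \<beta>_def
  proof (rule restrict_in_delta_maps)
    fix i assume "i \<le> m" then show "(if \<alpha> i < j then \<alpha> i else \<alpha> i - 1) \<le> n - 1"
      using delta_maps_le[OF assms(1), of i] assms(2) by auto
  next
    fix i k assume "i \<le> k" "k \<le> m"
    then show "(if \<alpha> i < j then \<alpha> i else \<alpha> i - 1) \<le> (if \<alpha> k < j then \<alpha> k else \<alpha> k - 1)"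
      using delta_maps_mono[OF assms(1), of i k] ne[of i] ne[of k] by auto
  qed
  have "\<alpha> = delta_comp m (coface n j) \<beta>"
  proof (rule delta_maps_eqI[OF assms(1) delta_comp_in[OF \<beta> coface_in_maps[OF n assms(2)]]])
    fix i assume i: "i \<le> m"
    then have "\<beta> i \<le> n - 1" using \<beta> by (rule delta_maps_le[rotated])
    then show "\<alpha> i = delta_comp m (coface n j) \<beta> i"
      using i ne[of i] by (auto simp: coface_apply) (auto simp: \<beta>_def)
  qed
  with n \<beta> show ?thesis by (rule that)
qed

text \<open>
  A map that omits both \<open>i\<close> and \<open>j\<close> factors through the codimension-two face opposite to them. This is
  what makes data on the codimension-one faces well defined as soon as it matches on their
  intersections.
\<close>

lemma factor_through_two_cofaces:
  assumes "\<beta> \<in> delta_maps m (n - 1)" "\<beta>' \<in> delta_maps m (n - 1)" "i < j" "j \<le> n"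
    and eq: "delta_comp m (coface n i) \<beta> = delta_comp m (coface n j) \<beta>'"
  obtains \<rho> where "2 \<le> n" "\<rho> \<in> delta_maps m (n - 2)"
    "\<beta> = delta_comp m (coface (n - 1) (j - 1)) \<rho>" "\<beta>' = delta_comp m (coface (n - 1) i) \<rho>"
proof -
  have eq': "coface n i (\<beta> k) = coface n j (\<beta>' k)" "\<beta> k \<le> n - 1" "\<beta>' k \<le> n - 1" if "k \<le> m" for k
    using fun_cong[OF eq, of k] that assms(1,2) by (auto dest: delta_maps_le)
  have ne: "\<beta>' k \<noteq> i" if "k \<le> m" for k
    using eq'[OF that] assms(3) by (auto simp: coface_apply split: if_splits)
  have "i \<notin> \<beta>' ` {0..m}" by (rule notI, erule imageE) (metis ne atLeastAtMost_iff)
  from assms(3,4) have "i \<le> n - 1" by auto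
  from factor_through_coface[OF assms(2) this \<open>i \<notin> _\<close>] obtain \<rho> where
    n: "1 \<le> n - 1" and \<rho>: "\<rho> \<in> delta_maps m (n - 1 - 1)" and \<beta>': "\<beta>' = delta_comp m (coface (n - 1) i) \<rho>" .
  have c: "coface (n - 1) (j - 1) \<in> delta_maps (n - 1 - 1) (n - 1)"
    using n assms by (intro coface_in_maps) auto
  have "\<beta> = delta_comp m (coface (n - 1) (j - 1)) \<rho>"
  proof (rule delta_maps_eqI[OF assms(1) delta_comp_in[OF \<rho> c]])
    fix k assume k: "k \<le> m"
    with \<rho> have "\<rho> k \<le> n - 1 - 1" by (rule delta_maps_le)
    then show "\<beta> k = delta_comp m (coface (n - 1) (j - 1)) \<rho> k"
      using k eq'[OF k] assms(3,4) n by (auto simp: \<beta>' coface_apply split: if_splits)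
  qed
  with n \<rho> \<beta>' show ?thesis by (intro that[of \<rho>]) (auto simp: numeral_2_eq_2)
qed

lemma delta_inj_maps_ge:
  assumes "\<alpha> \<in> delta_inj_maps m n" "i \<le> m"
  shows "i \<le> \<alpha> i"
  using assms(2)
proof (induction i)
  case (Suc i)
  have "\<alpha> i < \<alpha> (Suc i)" using assms(1) Suc.prems by (auto simp: delta_inj_maps_def strict_mono_on_def)
  with Suc show ?case by auto
qed simp

lemma delta_inj_maps_dim: "\<alpha> \<in> delta_inj_maps m n \<Longrightarrow> m \<le> n"
  using delta_inj_maps_ge[of \<alpha> m n m] delta_maps_le[of \<alpha> m n m] delta_inj_mapsD[of \<alpha> m n] by auto

lemma delta_inj_endo:
  assumes \<alpha>: "\<alpha> \<in> delta_inj_maps m m" shows "\<alpha> = delta_id m"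
proof (rule delta_maps_eqI[OF delta_inj_mapsD[OF \<alpha>] delta_inj_mapsD[OF delta_id_in]])
  have "\<alpha> (m - i) \<le> m - i" if "i \<le> m" for i using that
  proof (induction i)
    case 0 then show ?case using delta_maps_le[OF delta_inj_mapsD[OF \<alpha>], of m] by simp
  next
    case (Suc i)
    have "\<alpha> (m - Suc i) < \<alpha> (m - i)"
      using \<alpha> Suc.prems by (auto simp: delta_inj_maps_def strict_mono_on_def)
    with Suc show ?case by auto
  qed
  then have "\<alpha> (m - (m - i)) \<le> m - (m - i)" for i using diff_le_self by blast
  then show "\<alpha> i = delta_id m i" if "i \<le> m" for i
    using delta_inj_maps_ge[OF \<alpha> that] that by (metis delta_id_apply diff_diff_cancel le_antisym)
qed

lemma delta_surj_endo:
  assumes \<alpha>: "\<alpha> \<in> delta_maps m m" and "{0..m} \<subseteq> \<alpha> ` {0..m}" shows "\<alpha> = delta_id m"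
  using assms by (intro delta_inj_endo) (auto simp: delta_inj_maps_iff intro: finite_surj_inj)

lemma coface_cancel:
  assumes "1 \<le> n" "j \<le> n" and \<beta>: "\<beta> \<in> delta_maps m (n - 1)" "\<beta>' \<in> delta_maps m (n - 1)"
    and eq: "delta_comp m (coface n j) \<beta> = delta_comp m (coface n j) \<beta>'"
  shows "\<beta> = \<beta>'"
proof (rule delta_maps_eqI[OF \<beta>])
  fix i assume i: "i \<le> m"
  then have "coface n j (\<beta> i) = coface n j (\<beta>' i)" using fun_cong[OF eq, of i] by simp
  then show "\<beta> i = \<beta>' i"
    using delta_inj_maps_eq_iff[OF coface_in[OF assms(1,2)]] \<beta> i by (simp add: delta_maps_le)
qed

text \<open>
  A section has to pick one element of each fibre; over \<open>\<sigma> p\<close> the element \<open>p\<close> can be picked. Any such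
  choice is strictly monotone because \<open>\<sigma>\<close> is monotone.
\<close>

lemma section_through:
  assumes \<sigma>: "\<sigma> \<in> delta_maps n m" and surj: "{0..m} \<subseteq> \<sigma> ` {0..n}" and p: "p \<le> n"
  obtains \<delta> where "\<delta> \<in> delta_inj_maps m n" "delta_comp m \<sigma> \<delta> = delta_id m" "\<delta> (\<sigma> p) = p"
proof -
  have "\<forall>i. i \<le> m \<longrightarrow> (\<exists>q\<le>n. \<sigma> q = i \<and> (i = \<sigma> p \<longrightarrow> q = p))"
  proof (intro allI impI)
    fix i assume "i \<le> m"
    then have "i \<in> \<sigma> ` {0..n}" using surj by (auto dest: subsetD)
    then obtain q where "q \<le> n" "\<sigma> q = i" by auto
    then show "\<exists>q\<le>n. \<sigma> q = i \<and> (i = \<sigma> p \<longrightarrow> q = p)" using p by (cases "i = \<sigma> p") auto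
  qed
  then obtain d where d: "\<And>i. i \<le> m \<Longrightarrow> d i \<le> n \<and> \<sigma> (d i) = i \<and> (i = \<sigma> p \<longrightarrow> d i = p)" by metis
  define \<delta> where "\<delta> = restrict d {0..m}"
  have dn: "d i \<le> n" if "i \<le> m" for i using d[OF that] by (rule conjunct1)
  have \<sigma>d: "\<sigma> (d i) = i" if "i \<le> m" for i using d[OF that, THEN conjunct2] by (rule conjunct1)
  have less: "d i < d j" if "i < j" "j \<le> m" for i j
  proof (rule ccontr)
    assume "\<not> d i < d j"
    then have "\<sigma> (d j) \<le> \<sigma> (d i)" using dn[of i] that by (intro delta_maps_mono[OF \<sigma>]) auto
    then show False using that by (simp add: \<sigma>d)
  qed
  have le: "d i \<le> d j" if "i \<le> j" "j \<le> m" for i j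
    using less[of i j] that by (cases "i = j") auto
  have "\<delta> \<in> delta_maps m n" unfolding \<delta>_def by (rule restrict_in_delta_maps) (simp_all add: dn le)
  moreover have "inj_on \<delta> {0..m}"
  proof (rule inj_onI)
    fix i j assume "i \<in> {0..m}" "j \<in> {0..m}" "\<delta> i = \<delta> j"
    then have ij: "i \<le> m" "j \<le> m" "d i = d j" by (simp_all add: \<delta>_def)
    show "i = j" using arg_cong[OF ij(3), of \<sigma>] unfolding \<sigma>d[OF ij(1)] \<sigma>d[OF ij(2)] .
  qed
  ultimately have \<delta>: "\<delta> \<in> delta_inj_maps m n" by (simp add: delta_inj_maps_iff)
  have "delta_comp m \<sigma> \<delta> = delta_id m"
    by (rule delta_maps_eqI[OF delta_comp_in[OF delta_inj_mapsD[OF \<delta>] \<sigma>] delta_inj_mapsD[OF delta_id_in]])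
      (simp add: \<delta>_def \<sigma>d)
  moreover have "\<delta> (\<sigma> p) = p" using d[of "\<sigma> p"] delta_maps_le[OF \<sigma> p] by (simp add: \<delta>_def)
  ultimately show ?thesis using \<delta> by (intro that)
qed

section \<open>Filling horns face by face\<close>

lemma act_in_cells:
  "semisimplicial_set X \<Longrightarrow> \<alpha> \<in> delta_inj_maps m n \<Longrightarrow> x \<in> cells X n \<Longrightarrow> act X m n \<alpha> x \<in> cells X m"
  by (auto simp: semisimplicial_set_def presheaf_on_def)

lemma act_id: "semisimplicial_set X \<Longrightarrow> x \<in> cells X n \<Longrightarrow> act X n n (delta_id n) x = x"
  by (auto simp: semisimplicial_set_def presheaf_on_def)

lemma act_comp:
  "semisimplicial_set X \<Longrightarrow> \<alpha> \<in> delta_inj_maps k m \<Longrightarrow> \<beta> \<in> delta_inj_maps m n \<Longrightarrow> x \<in> cells X n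
    \<Longrightarrow> act X k n (delta_comp k \<beta> \<alpha>) x = act X k m \<alpha> (act X m n \<beta> x)"
  by (auto simp: semisimplicial_set_def presheaf_on_def)

lemma face_in_cells:
  "semisimplicial_set X \<Longrightarrow> 1 \<le> n \<Longrightarrow> i \<le> n \<Longrightarrow> x \<in> cells X n \<Longrightarrow> face X n i x \<in> cells X (n - 1)"
  unfolding face_def by (intro act_in_cells coface_in)

lemma face_face:
  assumes "semisimplicial_set X" "i < j" "j \<le> n" "2 \<le> n" "x \<in> cells X n"
  shows "face X (n - 1) i (face X n j x) = face X (n - 1) (j - 1) (face X n i x)"
proof -
  have c: "coface (n - 1) l \<in> delta_inj_maps (n - 2) (n - 1)" if "l \<le> n - 1" for l
    using coface_in[of "n-1" l] that assms(4) by (simp add: numeral_2_eq_2)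
  have "face X (n - 1) l (face X n m x) = act X (n - 2) n (delta_comp (n - 2) (coface n m) (coface (n - 1) l)) x"
    if "l \<le> n - 1" "m \<le> n" for l m
    using act_comp[OF assms(1) c[OF that(1)] coface_in[of n m] assms(5)] that assms(4)
    by (simp add: face_def numeral_2_eq_2)
  with assms coface_coface[OF assms(2-4)] show ?thesis by simp
qed

lemma edge_in: "a < b \<Longrightarrow> b \<le> n \<Longrightarrow> edge a b \<in> delta_inj_maps 1 n"
  unfolding delta_inj_maps_iff edge_def by (auto intro!: restrict_in_delta_maps simp: inj_on_def)

text \<open>
  A map out of a horn is the same as a family of matching faces. Passing from the family to the map
  means writing a cell of the horn as a cell of one of the faces; by
  \<open>factor_through_two_cofaces\<close> the result does not depend on the face. The edge of the horn that has to
  be an equivalence in the outer cases is read off from the face that is farthest from the missing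
  one.
\<close>

lemma horn_fill:
  assumes X: "quasi_semicategory X" and n: "2 \<le> n" and k: "k \<le> n"
    and z: "\<And>i. i \<le> n \<Longrightarrow> i \<noteq> k \<Longrightarrow> z i \<in> cells X (n - 1)"
    and match: "\<And>i j. i < j \<Longrightarrow> j \<le> n \<Longrightarrow> i \<noteq> k \<Longrightarrow> j \<noteq> k \<Longrightarrow>
      face X (n - 1) i (z j) = face X (n - 1) (j - 1) (z i)"
    and first: "k = 0 \<Longrightarrow> equivalence X (act X 1 (n - 1) (edge 0 1) (z n))"
    and last: "k = n \<Longrightarrow> equivalence X (act X 1 (n - 1) (edge (n - 2) (n - 1)) (z 0))"
  obtains x where "x \<in> cells X n" "\<And>i. i \<le> n \<Longrightarrow> i \<noteq> k \<Longrightarrow> face X n i x = z i"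
proof -
  have S: "semisimplicial_set X" using X by (simp add: quasi_semicategory_def)
  define lifts where "lifts m \<gamma> j \<beta> \<longleftrightarrow>
      j \<le> n \<and> j \<noteq> k \<and> \<beta> \<in> delta_inj_maps m (n - 1) \<and> \<gamma> = delta_comp m (coface n j) \<beta>" for m \<gamma> j \<beta>
  \<comment> \<open>The map out of the horn, computed on an arbitrarily chosen face.\<close>
  define \<phi> where "\<phi> m \<gamma> = (case SOME p. lifts m \<gamma> (fst p) (snd p) of (j, \<beta>) \<Rightarrow> act X m (n - 1) \<beta> (z j))"
    for m \<gamma>
  have indep_less: "act X m (n - 1) \<beta> (z j) = act X m (n - 1) \<beta>' (z j')"
    if l: "lifts m \<gamma> j \<beta>" "lifts m \<gamma> j' \<beta>'" and "j < j'" for m \<gamma> j \<beta> j' \<beta>'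
  proof -
    have eq: "delta_comp m (coface n j) \<beta> = delta_comp m (coface n j') \<beta>'"
      using l by (simp add: lifts_def)
    have \<beta>: "\<beta> \<in> delta_inj_maps m (n - 1)" "\<beta>' \<in> delta_inj_maps m (n - 1)"
      and j: "j \<le> n" "j \<noteq> k" "j' \<le> n" "j' \<noteq> k"
      using l by (auto simp: lifts_def)
    obtain \<rho> where \<rho>: "\<rho> \<in> delta_maps m (n - 2)"
      and b: "\<beta> = delta_comp m (coface (n - 1) (j' - 1)) \<rho>" "\<beta>' = delta_comp m (coface (n - 1) j) \<rho>"
      using factor_through_two_cofaces[OF \<beta>[THEN delta_inj_mapsD] \<open>j < j'\<close> j(3) eq] .
    have \<rho>': "\<rho> \<in> delta_inj_maps m (n - 2)"
      using \<beta>(1) \<rho> unfolding b by (rule delta_comp_inj_right)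
    have c: "coface (n - 1) l \<in> delta_inj_maps (n - 2) (n - 1)" if "l \<le> n - 1" for l
      using coface_in[of "n-1" l] that n by (simp add: numeral_2_eq_2)
    have f: "act X m (n - 1) (delta_comp m (coface (n - 1) l) \<rho>) (z i) = act X m (n - 2) \<rho> (face X (n - 1) l (z i))"
      if "l \<le> n - 1" "i \<le> n" "i \<noteq> k" for l i
      using act_comp[OF S \<rho>' c[OF that(1)] z[OF that(2,3)]] by (simp add: face_def numeral_2_eq_2)
    show ?thesis unfolding b
      using j \<open>j < j'\<close> f[of "j' - 1" j] f[of j j'] match[of j j'] by simp
  qed
  have \<phi>_eq: "\<phi> m \<gamma> = act X m (n - 1) \<beta> (z j)" if l: "lifts m \<gamma> j \<beta>" for m \<gamma> j \<beta>
  proof -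
    obtain j' \<beta>' where p: "(SOME p. lifts m \<gamma> (fst p) (snd p)) = (j', \<beta>')" by fastforce
    with someI[of "\<lambda>p. lifts m \<gamma> (fst p) (snd p)" "(j, \<beta>)"] l have l': "lifts m \<gamma> j' \<beta>'" by simp
    have "act X m (n - 1) \<beta>' (z j') = act X m (n - 1) \<beta> (z j)"
    proof (cases j j' rule: linorder_cases)
      case equal
      with l l' n have "\<beta> = \<beta>'"
        using coface_cancel[of n j \<beta> m \<beta>'] by (simp add: lifts_def delta_inj_mapsD)
      with equal show ?thesis by simp
    qed (use indep_less l l' in metis)+
    with p show ?thesis by (simp add: \<phi>_def)
  qed
  have horn_lifts: "\<exists>j \<beta>. lifts m \<gamma> j \<beta>" if "\<gamma> \<in> cells (horn n k) m" for m \<gamma>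
    using that by (auto simp: horn_def simplex_face_cells_def lifts_def)
  have sm: "semisimplicial_map (horn n k) X \<phi>"
    unfolding semisimplicial_map_def
  proof safe
    fix m \<gamma> assume "\<gamma> \<in> cells (horn n k) m"
    then obtain j \<beta> where l: "lifts m \<gamma> j \<beta>" using horn_lifts by blast
    then show "\<phi> m \<gamma> \<in> cells X m"
      unfolding \<phi>_eq[OF l] using act_in_cells[OF S _ z] by (simp add: lifts_def)
  next
    fix m' m \<alpha> \<gamma> assume \<alpha>: "\<alpha> \<in> delta_inj_maps m' m" and "\<gamma> \<in> cells (horn n k) m"
    then obtain j \<beta> where l: "lifts m \<gamma> j \<beta>" using horn_lifts by blast
    have l': "lifts m' (delta_comp m' \<gamma> \<alpha>) j (delta_comp m' \<beta> \<alpha>)"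
      using l \<alpha> by (auto simp: lifts_def delta_comp_assoc[OF delta_inj_mapsD[OF \<alpha>], symmetric] delta_comp_in_inj)
    have "act (horn n k) m' m \<alpha> \<gamma> = delta_comp m' \<gamma> \<alpha>" by (simp add: horn_def std_simplex_def)
    then show "\<phi> m' (act (horn n k) m' m \<alpha> \<gamma>) = act X m' m \<alpha> (\<phi> m \<gamma>)"
      using act_comp[OF S \<alpha> _ z, of \<beta> j] l unfolding \<phi>_eq[OF l] \<open>act (horn n k) _ _ _ _ = _\<close> \<phi>_eq[OF l']
      by (simp add: lifts_def)
  qed
  have edge_lift: "\<phi> 1 (edge a b) = act X 1 (n - 1) (edge a' b') (z j)"
    if "j \<le> n" "j \<noteq> k" "a' < b'" "b' \<le> n - 1" "coface n j a' = a" "coface n j b' = b" for a b a' b' j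
  proof (rule \<phi>_eq)
    have "edge a b = delta_comp 1 (coface n j) (edge a' b')"
      using that(5,6) by (auto simp: edge_def delta_comp_def compose_def restrict_def fun_eq_iff)
    then show "lifts 1 (edge a b) j (edge a' b')"
      using that edge_in[of a' b' "n-1"] by (auto simp: lifts_def)
  qed
  have "has_filler X n k \<phi>"
  proof -
    consider "0 < k" "k < n" | "k = 0" | "k = n" using k by linarith
    then show ?thesis
    proof cases
      case 1 then show ?thesis using X sm by (simp add: quasi_semicategory_def)
    next
      case 2
      have "\<phi> 1 (edge 0 1) = act X 1 (n - 1) (edge 0 1) (z n)"
        using edge_lift[of n 0 1 0 1] 2 n by (simp add: coface_apply)
      then show ?thesis using first[OF 2] sm n 2 unfolding equivalence_def by auto
    next
      case 3
      have "\<phi> 1 (edge (n - 1) n) = act X 1 (n - 1) (edge (n - 2) (n - 1)) (z 0)"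
        using edge_lift[of 0 "n - 2" "n - 1" "n - 1" n] 3 n by (simp add: coface_apply)
      then show ?thesis using last[OF 3] sm n 3 unfolding equivalence_def by auto
    qed
  qed
  then obtain \<psi> where \<psi>: "semisimplicial_map (std_simplex n) X \<psi>"
    and ext: "\<And>m \<gamma>. \<gamma> \<in> cells (horn n k) m \<Longrightarrow> \<psi> m \<gamma> = \<phi> m \<gamma>"
    by (auto simp: has_filler_def)
  have id: "delta_id n \<in> cells (std_simplex n) n" by (simp add: std_simplex_def delta_id_in)
  show ?thesis
  proof (rule that[of "\<psi> n (delta_id n)"])
    show "\<psi> n (delta_id n) \<in> cells X n" using \<psi> id by (auto simp: semisimplicial_map_def)
  next
    fix i assume i: "i \<le> n" "i \<noteq> k"
    have c: "coface n i \<in> delta_inj_maps (n - 1) n" using i n by (intro coface_in) auto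
    have l: "lifts (n - 1) (coface n i) i (delta_id (n - 1))"
      using i delta_comp_id_right[OF delta_inj_mapsD[OF c]] by (simp add: lifts_def delta_id_in)
    then have h: "coface n i \<in> cells (horn n k) (n - 1)"
      unfolding horn_def simplex_face_cells_def lifts_def using i by auto
    have "face X n i (\<psi> n (delta_id n)) = \<psi> (n - 1) (act (std_simplex n) (n - 1) n (coface n i) (delta_id n))"
      using \<psi> id c by (auto simp: semisimplicial_map_def face_def)
    also have "act (std_simplex n) (n - 1) n (coface n i) (delta_id n) = coface n i"
      using delta_comp_id_left[OF delta_inj_mapsD[OF c]] by (simp add: std_simplex_def)
    also have "\<psi> (n - 1) (coface n i) = z i"
      using ext[OF h] \<phi>_eq[OF l] act_id[OF S z[OF i]] by simp
    finally show "face X n i (\<psi> n (delta_id n)) = z i" .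
  qed
qed

section \<open>Words\<close>

definition word_of :: "nat \<Rightarrow> (nat \<Rightarrow> nat) \<Rightarrow> nat list" where
  "word_of n \<tau> = map \<tau> [0..<Suc n]"

text \<open>
  The \<open>i\<close>-th face of a word. For words over any alphabet it satisfies the simplicial identities, so
  that a set of nonempty words closed under \<open>omit\<close> is a semisimplicial set whose \<open>n\<close>-cells are its words of
  length \<open>n + 1\<close>.
\<close>

definition omit :: "nat \<Rightarrow> 'b list \<Rightarrow> 'b list" where
  "omit i w = take i w @ drop (Suc i) w"

lemma length_omit [simp]: "i < length w \<Longrightarrow> length (omit i w) = length w - 1"
  by (auto simp: omit_def)

lemma nth_omit: "i < length w \<Longrightarrow> j < length w - 1 \<Longrightarrow> omit i w ! j = w ! (if j < i then j else Suc j)"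
  by (auto simp: omit_def nth_append min_def)

lemma omit_omit:
  "i < j \<Longrightarrow> j < length w \<Longrightarrow> omit i (omit j w) = omit (j - 1) (omit i w)"
  by (rule nth_equalityI) (auto simp: nth_omit)

lemma map_omit: "map f (omit i w) = omit i (map f w)"
  by (simp add: omit_def take_map drop_map)

lemma omit_append:
  "omit i (u @ v) = (if i < length u then omit i u @ v else u @ omit (i - length u) v)"
  by (auto simp: omit_def Suc_diff_le)

lemma omit_Cons_0: "omit 0 (x # v) = v" by (simp add: omit_def)

lemma omit_replicate: "i < a \<Longrightarrow> omit i (replicate a x) = replicate (a - 1) x"
  by (auto simp: omit_def simp flip: replicate_add)

lemma set_omit: "set (omit i w) \<subseteq> set w"
  by (auto simp: omit_def dest: in_set_takeD in_set_dropD)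

lemma sorted_omit: "i < length w \<Longrightarrow> sorted w \<Longrightarrow> sorted (omit i w)"
  by (auto simp: sorted_iff_nth_mono nth_omit)

lemma length_word_of [simp]: "length (word_of n \<tau>) = Suc n"
  by (simp add: word_of_def)

lemma word_of_comp_coface:
  assumes "1 \<le> n" "i \<le> n"
  shows "word_of (n - 1) (delta_comp (n - 1) \<tau> (coface n i)) = omit i (word_of n \<tau>)"
  using assms
  by (intro nth_equalityI) (auto simp: word_of_def nth_omit coface_apply simp del: upt_Suc)

definition face_closed :: "'b list set \<Rightarrow> bool" where
  "face_closed T \<longleftrightarrow> (\<forall>w\<in>T. w \<noteq> [] \<and> (2 \<le> length w \<longrightarrow> (\<forall>i<length w. omit i w \<in> T)))"

text \<open>
  A semisimplicial map from a face-closed set of words to \<open>X\<close>; compatibility with the codimension-one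
  faces suffices, since the cofaces generate all injective maps (\<open>word_map_act\<close>).
\<close>

definition word_map :: "'a presheaf \<Rightarrow> 'b list set \<Rightarrow> ('b list \<Rightarrow> 'a) \<Rightarrow> bool" where
  "word_map X T F \<longleftrightarrow> (\<forall>w\<in>T. F w \<in> cells X (length w - 1) \<and>
     (2 \<le> length w \<longrightarrow> (\<forall>i<length w. face X (length w - 1) i (F w) = F (omit i w))))"

lemma face_closed_omit:
  "face_closed T \<Longrightarrow> w \<in> T \<Longrightarrow> 2 \<le> length w \<Longrightarrow> i < length w \<Longrightarrow> omit i w \<in> T"
  by (simp add: face_closed_def)

lemma word_map_cells: "word_map X T F \<Longrightarrow> w \<in> T \<Longrightarrow> length w = Suc n \<Longrightarrow> F w \<in> cells X n"
  by (metis diff_Suc_1 word_map_def)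

lemma word_map_face:
  "word_map X T F \<Longrightarrow> w \<in> T \<Longrightarrow> length w = Suc n \<Longrightarrow> 1 \<le> n \<Longrightarrow> i \<le> n \<Longrightarrow> face X n i (F w) = F (omit i w)"
  unfolding word_map_def by (drule bspec, assumption) simp

lemma word_map_act:
  assumes S: "semisimplicial_set X" and T: "face_closed T" and F: "word_map X T F"
    and "w \<in> T" "length w = Suc n" "\<alpha> \<in> delta_inj_maps m n"
  shows "act X m n \<alpha> (F w) = F (map (\<lambda>i. w ! \<alpha> i) [0..<Suc m])"
  using assms(4-)
proof (induction n arbitrary: w \<alpha>)
  case 0
  then have "m = 0" using delta_inj_maps_dim by fastforce
  with 0 have "\<alpha> = delta_id 0" by (simp add: delta_inj_endo)
  moreover have "w = [w ! 0]" using 0 by (cases w) auto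
  ultimately show ?case using \<open>m = 0\<close> act_id[OF S word_map_cells[OF F 0(1,2)]] by simp
next
  case (Suc n)
  have m: "m \<le> Suc n" using Suc.prems delta_inj_maps_dim by blast
  show ?case
  proof (cases "m = Suc n")
    case True
    with Suc.prems have \<alpha>: "\<alpha> = delta_id m" by (simp add: delta_inj_endo)
    have "map (\<lambda>i. w ! \<alpha> i) [0..<Suc m] = w"
      using Suc.prems True \<alpha> by (intro nth_equalityI) (auto simp del: upt_Suc)
    then show ?thesis using act_id[OF S word_map_cells[OF F Suc.prems(1,2)]] \<alpha> True by simp
  next
    case False
    with m have "card (\<alpha> ` {0..m}) < card {0..Suc n}"
      using card_image_le[of "{0..m}" \<alpha>] by simp
    then have "\<not> {0..Suc n} \<subseteq> \<alpha> ` {0..m}" by (meson card_mono finite_atLeastAtMost finite_imageI leD)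
    then obtain j where j: "j \<le> Suc n" "j \<notin> \<alpha> ` {0..m}"
      by (meson atLeastAtMost_iff subsetI)
    obtain \<beta> where "\<beta> \<in> delta_maps m (Suc n - 1)" and \<alpha>: "\<alpha> = delta_comp m (coface (Suc n) j) \<beta>"
      using factor_through_coface[OF delta_inj_mapsD[OF Suc.prems(3)] j] .
    then have \<beta>: "\<beta> \<in> delta_inj_maps m n"
      using Suc.prems(3) delta_comp_inj_right by simp
    have c: "coface (Suc n) j \<in> delta_inj_maps n (Suc n)" using coface_in[of "Suc n" j] j by simp
    have o: "omit j w \<in> T" "length (omit j w) = Suc n"
      using Suc.prems j face_closed_omit[OF T Suc.prems(1)] by auto
    have "act X m (Suc n) \<alpha> (F w) = act X m n \<beta> (face X (Suc n) j (F w))"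
      using act_comp[OF S \<beta> c word_map_cells[OF F Suc.prems(1,2)]] by (simp add: \<alpha> face_def)
    also have "\<dots> = act X m n \<beta> (F (omit j w))"
      using word_map_face[OF F Suc.prems(1,2)] j by simp
    also have "\<dots> = F (map (\<lambda>i. omit j w ! \<beta> i) [0..<Suc m])"
      by (rule Suc.IH[OF o \<beta>])
    also have "map (\<lambda>i. omit j w ! \<beta> i) [0..<Suc m] = map (\<lambda>i. w ! \<alpha> i) [0..<Suc m]"
      using Suc.prems j delta_maps_le[OF delta_inj_mapsD[OF \<beta>]]
      by (auto simp: \<alpha> nth_omit coface_apply less_Suc_eq_le simp del: upt_Suc)
    finally show ?thesis .
  qed
qed

lemma word_of_inject:
  assumes "\<tau> \<in> delta_maps n M" "\<tau>' \<in> delta_maps n M" "word_of n \<tau> = word_of n \<tau>'"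
  shows "\<tau> = \<tau>'"
  using assms(3) by (intro delta_maps_eqI[OF assms(1,2)]) (simp add: word_of_def del: upt_Suc)

lemma word_of_props:
  assumes "\<tau> \<in> delta_maps n M"
  shows "word_of n \<tau> \<noteq> []" "sorted (word_of n \<tau>)" "set (word_of n \<tau>) = \<tau> ` {0..n}" "set (word_of n \<tau>) \<subseteq> {..M}"
proof -
  show "word_of n \<tau> \<noteq> []" by (simp add: word_of_def)
  show "sorted (word_of n \<tau>)"
    using delta_maps_mono[OF assms] by (auto simp: word_of_def sorted_iff_nth_mono simp del: upt_Suc)
  show "set (word_of n \<tau>) = \<tau> ` {0..n}" by (simp add: word_of_def atLeastLessThanSuc_atLeastAtMost del: upt_Suc)
  then show "set (word_of n \<tau>) \<subseteq> {..M}" using delta_maps_le[OF assms] by auto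
qed

lemma word_of_surj:
  assumes "w \<noteq> []" "sorted w" "set w \<subseteq> {..M}"
  obtains \<tau> where "\<tau> \<in> delta_maps (length w - 1) M" "word_of (length w - 1) \<tau> = w"
proof (rule that)
  let ?\<tau> = "restrict (\<lambda>i. w ! i) {0..length w - 1}"
  have l: "i \<le> length w - Suc 0 \<longleftrightarrow> i < length w" for i using assms(1) by (cases w) auto
  show "?\<tau> \<in> delta_maps (length w - 1) M"
  proof (rule restrict_in_delta_maps)
    fix i assume "i \<le> length w - 1"
    then have "w ! i \<in> set w" by (simp add: l)
    with assms(3) show "w ! i \<le> M" by auto
  qed (simp add: l sorted_nth_mono[OF assms(2)])
  show "word_of (length w - 1) ?\<tau> = w"
    using assms(1) by (intro nth_equalityI) (simp_all add: word_of_def l del: upt_Suc)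
qed

lemma word_map_act_word_of:
  assumes S: "semisimplicial_set X" and T: "face_closed T" and F: "word_map X T F"
    and "word_of n \<tau> \<in> T" and \<rho>: "\<rho> \<in> delta_inj_maps k n"
  shows "act X k n \<rho> (F (word_of n \<tau>)) = F (word_of k (delta_comp k \<tau> \<rho>))"
proof -
  have "map (\<lambda>i. word_of n \<tau> ! \<rho> i) [0..<Suc k] = word_of k (delta_comp k \<tau> \<rho>)"
    using delta_maps_le[OF delta_inj_mapsD[OF \<rho>]]
    by (auto simp: word_of_def less_Suc_eq_le simp del: upt_Suc)
  then show ?thesis using word_map_act[OF S T F assms(4) length_word_of \<rho>] by simp
qed

lemma face_closed_words: "face_closed {w. w \<noteq> [] \<and> sorted w \<and> set w \<subseteq> {..M::nat}}"
proof -
  have "omit i w \<noteq> []" if "2 \<le> length w" "i < length w" for i and w :: "nat list"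
    using length_omit[OF that(2)] that(1) by (auto simp del: length_omit)
  then show ?thesis using set_omit sorted_omit unfolding face_closed_def by fast
qed

section \<open>Extending a map on words along horns\<close>

text \<open>
  The horns of the words in \<open>P\<close> can be filled independently of each other, because their missing faces are
  new and pairwise different. Each filler gives a value on the word and one on its missing face. The
  faces of the missing face are faces of the other faces, which makes the new values compatible with
  the old ones.
\<close>

lemma fill_layer:
  fixes P :: "'b list set" and \<kappa> :: "'b list \<Rightarrow> nat"
  defines "miss \<equiv> \<lambda>w. omit (\<kappa> w) w"
  assumes X: "quasi_semicategory X" and T: "face_closed T" and F: "word_map X T F"
    and P: "\<And>w. w \<in> P \<Longrightarrow> 3 \<le> length w \<and> \<kappa> w < length w"
    and faces: "\<And>w i. w \<in> P \<Longrightarrow> i < length w \<Longrightarrow> i \<noteq> \<kappa> w \<Longrightarrow> omit i w \<in> T"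
    and new: "\<And>w. w \<in> P \<Longrightarrow> miss w \<notin> T" and inj: "inj_on miss P" and disj: "miss ` P \<inter> P = {}"
    and first: "\<And>w. w \<in> P \<Longrightarrow> \<kappa> w = 0 \<Longrightarrow> equivalence X (F [w ! 0, w ! 1])"
    and last: "\<And>w. w \<in> P \<Longrightarrow> Suc (\<kappa> w) = length w \<Longrightarrow> equivalence X (F [w ! (\<kappa> w - 1), w ! \<kappa> w])"
  shows "face_closed (T \<union> P \<union> miss ` P) \<and>
    (\<exists>F'. word_map X (T \<union> P \<union> miss ` P) F' \<and> (\<forall>w\<in>T. F' w = F w))"
proof -
  have S: "semisimplicial_set X" using X by (simp add: quasi_semicategory_def)
  have miss_omit: "omit i (miss w) \<in> T" if w: "w \<in> P" and i: "i < length w - 1" for w i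
  proof (cases "i < \<kappa> w")
    case True
    then have "omit i (miss w) = omit (\<kappa> w - 1) (omit i w)"
      using P[OF w] by (simp add: miss_def omit_omit)
    moreover have "2 \<le> length w - 1" "\<kappa> w - 1 < length w - 1" using P[OF w] True i by auto
    ultimately show ?thesis
      using face_closed_omit[OF T faces[OF w, of i], of "\<kappa> w - 1"] True i by simp
  next
    case False
    then have "omit i (miss w) = omit (\<kappa> w) (omit (Suc i) w)"
      using P[OF w] i by (simp add: miss_def omit_omit)
    moreover have "2 \<le> length w - 1" "\<kappa> w < length w - 1" using P[OF w] False i by auto
    ultimately show ?thesis
      using face_closed_omit[OF T faces[OF w, of "Suc i"], of "\<kappa> w"] False i by simp
  qed
  have closed: "face_closed (T \<union> P \<union> miss ` P)"
    unfolding face_closed_def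
  proof (intro ballI conjI impI allI)
    fix w assume w: "w \<in> T \<union> P \<union> miss ` P"
    have "miss v \<noteq> []" if "v \<in> P" for v
      using P[OF that] length_omit[of "\<kappa> v" v] by (auto simp: miss_def simp del: length_omit)
    then show "w \<noteq> []" using w T P by (force simp: face_closed_def)
    fix i assume i: "2 \<le> length w" "i < length w"
    show "omit i w \<in> T \<union> P \<union> miss ` P"
    proof -
      consider "w \<in> T" | "w \<in> P" | v where "v \<in> P" "w = miss v" using w by blast
      then show ?thesis
      proof cases
        case 1 then show ?thesis using face_closed_omit[OF T] i by blast
      next
        case 2 then show ?thesis using faces[OF 2 i(2)] by (cases "i = \<kappa> w") (auto simp: miss_def)
      next
        case 3 then show ?thesis using miss_omit[OF 3(1)] i P[OF 3(1)] by (auto simp: miss_def)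
      qed
    qed
  qed
  have "\<exists>x. x \<in> cells X (length w - 1) \<and>
      (\<forall>i<length w. i \<noteq> \<kappa> w \<longrightarrow> face X (length w - 1) i x = F (omit i w))" if w: "w \<in> P" for w
  proof -
    define n where "n = length w - 1"
    have n: "2 \<le> n" "length w = Suc n" "\<kappa> w \<le> n" using P[OF w] by (auto simp: n_def)
    have o: "omit i w \<in> T" "length (omit i w) = Suc (n - 1)" if "i \<le> n" "i \<noteq> \<kappa> w" for i
      using faces[OF w] that n by auto
    have act: "act X 1 (n - 1) (edge a b) (F (omit i w)) = F [omit i w ! a, omit i w ! b]"
      if "i \<le> n" "i \<noteq> \<kappa> w" "a < b" "b \<le> n - 1" for i a b
      using word_map_act[OF S T F o[OF that(1,2)] edge_in[OF that(3,4)]] by (simp add: edge_def)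
    show ?thesis
    proof (rule horn_fill[OF X n(1,3), of "\<lambda>i. F (omit i w)"])
      fix i assume "i \<le> n" "i \<noteq> \<kappa> w"
      then show "F (omit i w) \<in> cells X (n - 1)" using word_map_cells[OF F o] by blast
    next
      fix i j assume ij: "i < j" "j \<le> n" "i \<noteq> \<kappa> w" "j \<noteq> \<kappa> w"
      then have "face X (n - 1) i (F (omit j w)) = F (omit i (omit j w))"
        using n by (intro word_map_face[OF F o]) auto
      also have "omit i (omit j w) = omit (j - 1) (omit i w)" using ij n by (intro omit_omit) auto
      also have "F (omit (j - 1) (omit i w)) = face X (n - 1) (j - 1) (F (omit i w))"
        using ij n by (intro word_map_face[OF F o, symmetric]) auto
      finally show "face X (n - 1) i (F (omit j w)) = face X (n - 1) (j - 1) (F (omit i w))" .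
    next
      assume "\<kappa> w = 0"
      then show "equivalence X (act X 1 (n - 1) (edge 0 1) (F (omit n w)))"
        using first[OF w] n act[of n 0 1] by (simp add: nth_omit)
    next
      assume "\<kappa> w = n"
      then show "equivalence X (act X 1 (n - 1) (edge (n - 2) (n - 1)) (F (omit 0 w)))"
        using last[OF w] n act[of 0 "n - 2" "n - 1"]
        by (simp add: nth_omit Suc_diff_Suc numeral_2_eq_2)
    next
      fix x assume "x \<in> cells X n" "\<And>i. i \<le> n \<Longrightarrow> i \<noteq> \<kappa> w \<Longrightarrow> face X n i x = F (omit i w)"
      then show ?thesis using n by (intro exI[of _ x]) (simp add: less_Suc_eq_le)
    qed
  qed
  then obtain Z where Z: "\<And>w. w \<in> P \<Longrightarrow> Z w \<in> cells X (length w - 1)"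
    and Zf: "\<And>w i. w \<in> P \<Longrightarrow> i < length w \<Longrightarrow> i \<noteq> \<kappa> w \<Longrightarrow> face X (length w - 1) i (Z w) = F (omit i w)"
    by metis
  \<comment> \<open>A word outside \<open>T\<close> and \<open>P\<close> is the missing face of a unique word \<open>v\<close> in \<open>P\<close>.\<close>
  define F' where "F' w = (if w \<in> T then F w else if w \<in> P then Z w
      else let v = inv_into P miss w in face X (length v - 1) (\<kappa> v) (Z v))" for w
  have F'T: "F' w = F w" if "w \<in> T" for w using that by (simp add: F'_def)
  have "w \<notin> T" if "w \<in> P" for w
    using face_closed_omit[OF T, of w "\<kappa> w"] new[OF that] P[OF that] by (auto simp: miss_def)
  then have F'P: "F' w = Z w" if "w \<in> P" for w using that by (simp add: F'_def)
  have F'miss: "F' (miss w) = face X (length w - 1) (\<kappa> w) (Z w)" if "w \<in> P" for w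
    using that new[OF that] disj inj by (auto simp: F'_def Let_def)
  have "word_map X (T \<union> P \<union> miss ` P) F'"
    unfolding word_map_def
  proof (intro ballI)
    fix w assume "w \<in> T \<union> P \<union> miss ` P"
    then consider "w \<in> T" | "w \<in> P" | v where "v \<in> P" "w = miss v" by blast
    then show "F' w \<in> cells X (length w - 1) \<and>
     (2 \<le> length w \<longrightarrow> (\<forall>i<length w. face X (length w - 1) i (F' w) = F' (omit i w)))"
    proof cases
      case 1
      then show ?thesis using F face_closed_omit[OF T 1] by (auto simp: F'T word_map_def)
    next
      case 2
      have "face X (length w - 1) i (Z w) = F' (omit i w)" if "i < length w" for i
        using F'miss[OF 2] faces[OF 2 that] Zf[OF 2 that] by (cases "i = \<kappa> w") (auto simp: miss_def F'T)
      with 2 Z[OF 2] show ?thesis by (simp add: F'P)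
    next
      case 3
      define n where "n = length v - 1"
      have n: "length v = Suc n" "2 \<le> n" "\<kappa> v \<le> n" using P[OF 3(1)] by (auto simp: n_def)
      have w: "length w = n" using 3 n by (simp add: miss_def)
      have Zv: "Z v \<in> cells X n" using Z[OF 3(1)] n by simp
      have o: "omit i v \<in> T" "length (omit i v) = Suc (n - 1)" if "i \<le> n" "i \<noteq> \<kappa> v" for i
        using faces[OF 3(1)] that n by auto
      have "face X (n - 1) i (face X n (\<kappa> v) (Z v)) = F (omit i w)" if i: "i < n" for i
      proof (cases "i < \<kappa> v")
        case True
        have "face X (n - 1) i (face X n (\<kappa> v) (Z v)) = face X (n - 1) (\<kappa> v - 1) (face X n i (Z v))"
          using True n Zv by (intro face_face[OF S])
        also have "face X n i (Z v) = F (omit i v)" using Zf[OF 3(1), of i] True i n by simp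
        also have "face X (n - 1) (\<kappa> v - 1) (F (omit i v)) = F (omit (\<kappa> v - 1) (omit i v))"
          using True n by (intro word_map_face[OF F o]) auto
        also have "omit (\<kappa> v - 1) (omit i v) = omit i w"
          using True n by (simp add: 3 miss_def omit_omit)
        finally show ?thesis .
      next
        case False
        have "face X (n - 1) i (face X n (\<kappa> v) (Z v)) = face X (n - 1) (\<kappa> v) (face X n (Suc i) (Z v))"
          using face_face[OF S, of "\<kappa> v" "Suc i" n "Z v"] False i n Zv by simp
        also have "face X n (Suc i) (Z v) = F (omit (Suc i) v)" using Zf[OF 3(1), of "Suc i"] False i n by simp
        also have "face X (n - 1) (\<kappa> v) (F (omit (Suc i) v)) = F (omit (\<kappa> v) (omit (Suc i) v))"
          using False i n by (intro word_map_face[OF F o]) auto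
        also have "omit (\<kappa> v) (omit (Suc i) v) = omit i w"
          using False i n by (simp add: 3 miss_def omit_omit)
        finally show ?thesis .
      qed
      moreover have "F' (omit i w) = F (omit i w)" if "i < n" for i
        using miss_omit[OF 3(1), of i] that n by (simp add: F'T 3)
      moreover have "F' w = face X n (\<kappa> v) (Z v)" using F'miss[OF 3(1)] 3 n by simp
      moreover have "face X n (\<kappa> v) (Z v) \<in> cells X (n - 1)"
        using n Zv by (intro face_in_cells[OF S]) auto
      ultimately show ?thesis using w n by simp
    qed
  qed
  with closed F'T show ?thesis by blast
qed

lemma word_map_Union:
  fixes L :: "nat \<Rightarrow> 'b list set"
  assumes L: "\<And>n. L n \<subseteq> L (Suc n)" "\<And>n. face_closed (L n)"
    and G: "\<And>n. word_map X (L n) (G n)" "\<And>n w. w \<in> L n \<Longrightarrow> G (Suc n) w = G n w"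
  shows "\<exists>F. word_map X (\<Union>n. L n) F \<and> (\<forall>n. \<forall>w\<in>L n. F w = G n w)"
proof -
  define F where "F w = G (LEAST n. w \<in> L n) w" for w
  have mono: "w \<in> L n \<Longrightarrow> w \<in> L (n + k)" for w n k
    by (induction k) (use L(1) in auto)
  have stable: "G (n + k) w = G n w" if "w \<in> L n" for w n k
    by (induction k) (use that mono G(2) in auto)
  have F: "F w = G n w" if w: "w \<in> L n" for w n
  proof -
    define m where "m = (LEAST n. w \<in> L n)"
    have "w \<in> L m" unfolding m_def by (rule LeastI) (rule w)
    moreover have "m \<le> n" unfolding m_def by (rule Least_le) (rule w)
    ultimately show ?thesis using stable[of w m "n - m"] by (simp add: F_def m_def)
  qed
  have "word_map X (\<Union>n. L n) F"
    unfolding word_map_def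
  proof (intro ballI)
    fix w assume "w \<in> (\<Union>n. L n)"
    then obtain n where n: "w \<in> L n" by blast
    then show "F w \<in> cells X (length w - 1) \<and>
      (2 \<le> length w \<longrightarrow> (\<forall>i<length w. face X (length w - 1) i (F w) = F (omit i w)))"
      using G(1)[of n] F[OF n] F[OF face_closed_omit[OF L(2) n]] unfolding word_map_def by auto
  qed
  with F show ?thesis by blast
qed

text \<open>
  The layers are the words of equal rank: a word can be filled once the words of smaller rank and
  their missing faces have been reached.
\<close>

lemma fill_ranked:
  fixes P :: "'b list set" and \<kappa> :: "'b list \<Rightarrow> nat" and r :: "'b list \<Rightarrow> nat"
  defines "miss \<equiv> \<lambda>w. omit (\<kappa> w) w"
  assumes X: "quasi_semicategory X" and T: "face_closed T" and F: "word_map X T F"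
    and P: "\<And>w. w \<in> P \<Longrightarrow> 3 \<le> length w \<and> \<kappa> w < length w"
    and faces: "\<And>w i. w \<in> P \<Longrightarrow> i < length w \<Longrightarrow> i \<noteq> \<kappa> w \<Longrightarrow>
      omit i w \<in> T \<or> (\<exists>v\<in>P. r v < r w \<and> (omit i w = v \<or> omit i w = miss v))"
    and new: "\<And>w. w \<in> P \<Longrightarrow> miss w \<notin> T" and inj: "inj_on miss P" and disj: "miss ` P \<inter> P = {}"
    and first: "\<And>w. w \<in> P \<Longrightarrow> \<kappa> w = 0 \<Longrightarrow> [w ! 0, w ! 1] \<in> T \<and> equivalence X (F [w ! 0, w ! 1])"
    and last: "\<And>w. w \<in> P \<Longrightarrow> Suc (\<kappa> w) = length w \<Longrightarrow>
      [w ! (\<kappa> w - 1), w ! \<kappa> w] \<in> T \<and> equivalence X (F [w ! (\<kappa> w - 1), w ! \<kappa> w])"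
  shows "\<exists>F'. word_map X (T \<union> P \<union> miss ` P) F' \<and> (\<forall>w\<in>T. F' w = F w)"
proof -
  define Q where "Q n = {w\<in>P. r w = n}" for n
  define L where "L n = T \<union> {w\<in>P. r w < n} \<union> miss ` {w\<in>P. r w < n}" for n
  have L0: "L 0 = T" by (simp add: L_def)
  have LSuc: "L (Suc n) = L n \<union> Q n \<union> miss ` Q n" for n
    by (auto simp: L_def Q_def less_Suc_eq)
  have TL: "T \<subseteq> L n" for n by (auto simp: L_def)
  define ok where "ok n G \<longleftrightarrow> face_closed (L n) \<and> word_map X (L n) G \<and> (\<forall>w\<in>T. G w = F w)" for n G
  have "\<exists>G'. ok (Suc n) G' \<and> (\<forall>w\<in>L n. G' w = G w)" if G: "ok n G" for n G
  proof -
    have fc: "face_closed (L n)" and wm: "word_map X (L n) G" and GF: "\<And>w. w \<in> T \<Longrightarrow> G w = F w"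
      using G by (auto simp: ok_def)
    have "face_closed (L n \<union> Q n \<union> miss ` Q n) \<and>
      (\<exists>G'. word_map X (L n \<union> Q n \<union> miss ` Q n) G' \<and> (\<forall>w\<in>L n. G' w = G w))"
      unfolding miss_def
    proof (rule fill_layer[OF X fc wm, of "Q n" \<kappa>])
      fix w assume w: "w \<in> Q n"
      then show "3 \<le> length w \<and> \<kappa> w < length w" using P by (simp add: Q_def)
      from w have wP: "w \<in> P" by (simp add: Q_def)
      show "omit (\<kappa> w) w \<notin> L n"
      proof
        assume "omit (\<kappa> w) w \<in> L n"
        then have m: "miss w \<in> L n" by (simp add: miss_def)
        have "v = w" if "v \<in> P" "miss w = miss v" for v using inj_onD[OF inj that(2) wP that(1)] by simp
        with m new[OF wP] disj w wP show False by (auto simp: L_def Q_def)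
      qed
      show "equivalence X (G [w ! 0, w ! 1])" if "\<kappa> w = 0"
        using first[OF wP that] GF by simp
      show "equivalence X (G [w ! (\<kappa> w - 1), w ! \<kappa> w])" if "Suc (\<kappa> w) = length w"
        using last[OF wP that] GF by simp
      show "omit i w \<in> L n" if "i < length w" "i \<noteq> \<kappa> w" for i
        using faces[OF wP that] w by (auto simp: L_def Q_def)
    next
      show "inj_on (\<lambda>w. omit (\<kappa> w) w) (Q n)"
        using inj by (auto simp: miss_def Q_def inj_on_def)
      show "(\<lambda>w. omit (\<kappa> w) w) ` Q n \<inter> Q n = {}" using disj by (auto simp: miss_def Q_def)
    qed
    then show ?thesis using GF TL[of n] unfolding ok_def LSuc by (metis subsetD)
  qed
  moreover have "ok 0 F" using T F by (simp add: ok_def L0)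
  ultimately obtain G where G: "\<And>n. ok n (G n)" "\<And>n w. w \<in> L n \<Longrightarrow> G (Suc n) w = G n w"
    using dependent_nat_choice[of ok "\<lambda>n G G'. \<forall>w\<in>L n. G' w = G w"] by metis
  obtain F' where F': "word_map X (\<Union>n. L n) F'" "\<And>n w. w \<in> L n \<Longrightarrow> F' w = G n w"
    using word_map_Union[of L X G] G unfolding ok_def LSuc by blast
  moreover have "(\<Union>n. L n) = T \<union> P \<union> miss ` P" by (auto simp: L_def)
  moreover have "F' w = F w" if "w \<in> T" for w
    using F'(2)[of w 0] G(1)[of 0] that L0 by (simp add: ok_def)
  ultimately show ?thesis by auto
qed

section \<open>All words in one letter\<close>

text \<open>
  The letters \<open>False\<close> and \<open>True\<close> stand for the vertex and its copy. Filling the word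
  \<open>False\<^sup>a True\<close> with the last face missing turns the values on \<open>False\<^sup>a\<^sup>-\<^sup>1 True\<close> into one on \<open>False\<^sup>a\<close>
  all of whose faces agree. The words with \<open>a \<le> 2\<close> are given beforehand: they consist of the vertex, the
  equivalence \<open>f\<close>, and the 2-cell that expresses \<open>f \<circ> f \<simeq> f\<close>. The last edge of each horn is \<open>f\<close>.
\<close>

lemma extend_over_vertex:
  assumes X: "quasi_semicategory X" and f: "equivalence X f" and idem: "idempotent_at X x f"
  shows "\<exists>D. word_map X {w. w \<noteq> [] \<and> set w \<subseteq> {0::nat}} D \<and> D [0] = x \<and> D [0, 0] = f"
proof -
  have S: "semisimplicial_set X" using X by (simp add: quasi_semicategory_def)
  obtain \<sigma> where \<sigma>: "\<sigma> \<in> cells X 2" "face X 2 0 \<sigma> = f" "face X 2 1 \<sigma> = f" "face X 2 2 \<sigma> = f"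
    and f1: "f \<in> cells X 1" "face X 1 0 f = x" "face X 1 1 f = x"
    using idem by (auto simp: idempotent_at_def composes_to_def arrow_def)
  have x: "x \<in> cells X 0" using face_in_cells[OF S _ _ f1(1), of 0] f1 by simp
  define F where "F w = (if length w = 1 then x else if length w = 2 then f else \<sigma>)" for w :: "bool list"
  define T where "T = {[False], [True], [False, False], [False, True], [False, False, True]}"
  define top where "top a = replicate a False @ [True]" for a
  define P where "P = top ` {3..}"
  define \<kappa> where "\<kappa> w = length w - 1" for w :: "bool list"
  have l: "length (top a) = Suc a" for a by (simp add: top_def)
  have \<kappa>: "\<kappa> (top a) = a" for a by (simp add: \<kappa>_def l)
  have omit_top: "omit i (top a) = (if i < a then top (a - 1) else replicate a False)" if "i \<le> a" for i a
    using that by (auto simp: top_def omit_append omit_replicate omit_Cons_0)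
  have T: "face_closed T" unfolding face_closed_def T_def by (auto simp: omit_def less_Suc_eq)
  have F: "word_map X T F"
    unfolding word_map_def T_def using x f1 \<sigma>
    by (auto simp: omit_def F_def less_Suc_eq numeral_2_eq_2 numeral_3_eq_3)
  have "\<exists>F'. word_map X (T \<union> P \<union> (\<lambda>w. omit (\<kappa> w) w) ` P) F' \<and> (\<forall>w\<in>T. F' w = F w)"
  proof (rule fill_ranked[OF X T F, where r = length])
    fix w assume "w \<in> P"
    then obtain a where a: "3 \<le> a" and w: "w = top a" by (auto simp: P_def)
    show "3 \<le> length w \<and> \<kappa> w < length w" using a by (simp add: \<kappa> w l)
    show "omit (\<kappa> w) w \<notin> T"
      using a by (auto simp: \<kappa> w omit_top T_def numeral_3_eq_3 Suc_le_eq gr0_conv_Suc Suc_less_eq2)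
    show "[w ! 0, w ! 1] \<in> T \<and> equivalence X (F [w ! 0, w ! 1])" if "\<kappa> w = 0"
      using that a by (simp add: \<kappa> w)
    show "[w ! (\<kappa> w - 1), w ! \<kappa> w] \<in> T \<and> equivalence X (F [w ! (\<kappa> w - 1), w ! \<kappa> w])"
      using a f by (simp add: \<kappa> w) (simp add: top_def nth_append T_def F_def)
    fix i assume "i < length w" "i \<noteq> \<kappa> w"
    then have i: "i < a" by (simp add: \<kappa> w l)
    then have o: "omit i w = top (a - 1)" by (simp add: w omit_top)
    show "omit i w \<in> T \<or> (\<exists>v\<in>P. length v < length w \<and> (omit i w = v \<or> omit i w = omit (\<kappa> v) v))"
    proof (cases "a = 3")
      case True then show ?thesis unfolding o by (simp add: top_def T_def numeral_2_eq_2)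
    next
      case False
      then have "top (a - 1) \<in> P" using a by (auto simp: P_def)
      moreover have "length (top (a - 1)) < length w" using a by (simp add: w l)
      ultimately show ?thesis unfolding o by blast
    qed
  next
    show "inj_on (\<lambda>w. omit (\<kappa> w) w) P"
      by (rule inj_onI) (auto simp: P_def \<kappa> omit_top)
    show "(\<lambda>w. omit (\<kappa> w) w) ` P \<inter> P = {}"
      by (auto simp: P_def \<kappa> omit_top) (auto simp: top_def dest: arg_cong[of _ _ set])
  qed
  then obtain F' where F': "word_map X (T \<union> P \<union> (\<lambda>w. omit (\<kappa> w) w) ` P) F'" and FF: "\<And>w. w \<in> T \<Longrightarrow> F' w = F w"
    by blast
  have mem: "replicate a False \<in> T \<union> P \<union> (\<lambda>w. omit (\<kappa> w) w) ` P" if a: "1 \<le> a" for a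
  proof -
    consider "a = 1" | "a = 2" | "3 \<le> a" using a by linarith
    then show ?thesis
    proof cases
      case 3
      then have "replicate a False = omit (\<kappa> (top a)) (top a)" "top a \<in> P"
        by (auto simp: \<kappa> omit_top P_def)
      then show ?thesis by blast
    qed (auto simp: T_def numeral_2_eq_2)
  qed
  define D where "D w = F' (replicate (length w) False)" for w :: "nat list"
  have "word_map X {w. w \<noteq> [] \<and> set w \<subseteq> {0}} D"
    unfolding word_map_def
  proof (intro ballI conjI impI allI)
    fix w :: "nat list" assume "w \<in> {w. w \<noteq> [] \<and> set w \<subseteq> {0}}"
    then have w: "1 \<le> length w" by (cases w) auto
    then have "length (replicate (length w) False) = Suc (length w - 1)" by simp
    note w' = word_map_cells[OF F' mem[OF w] this] word_map_face[OF F' mem[OF w] this]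
    show "D w \<in> cells X (length w - 1)" using w' by (simp add: D_def)
    fix i assume "2 \<le> length w" "i < length w"
    with w' show "face X (length w - 1) i (D w) = D (omit i w)"
      by (auto simp: D_def omit_replicate)
  qed
  moreover have "D [0] = x" "D [0, 0] = f" by (auto simp: D_def FF T_def F_def)
  ultimately show ?thesis by blast
qed

section \<open>From words missing a letter to all weakly increasing words\<close>

abbreviation unmarked :: "nat list \<Rightarrow> (nat \<times> bool) list" where
  "unmarked \<equiv> map (\<lambda>l. (l, False))"

lemma sorted_split_max:
  "sorted w \<Longrightarrow> set w \<subseteq> {..M} \<Longrightarrow>
    w = filter (\<lambda>l. l < M) w @ replicate (count_list w M) (M::nat)"
proof (induction w)
  case (Cons l w)
  show ?case
  proof (cases "l < M")
    case False
    with Cons.prems have "l = M" "set w \<subseteq> {M}"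
      by (auto simp: subset_iff intro: le_antisym)
    moreover from this have "filter (\<lambda>l. l < M) w = []" by (auto simp: filter_empty_conv)
    ultimately show ?thesis using Cons by simp
  qed (use Cons in auto)
qed simp

text \<open>
  Cut the word at its last repeated letter \<open>j\<close>.
\<close>

lemma repeated_letter_decomposition:
  assumes "sorted w" "set w = {..M}" "w \<noteq> [0..<Suc M]"
  shows "\<exists>u j a. sorted u \<and> set u = {..<j} \<and> j \<le> M \<and> 2 \<le> a \<and> w = u @ replicate a j @ [Suc j..<Suc M]"
  using assms
proof (induction M arbitrary: w)
  case 0
  then have "w = replicate (count_list w 0) 0" using sorted_split_max[of w 0] by simp
  then obtain a where a: "w = replicate a 0" ..
  with 0 have "2 \<le> a" by (cases a; cases "a - 1") auto
  with a show ?case by (intro exI[of _ "[]"] exI[of _ 0] exI[of _ a]) auto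
next
  case (Suc M)
  define u where "u = filter (\<lambda>l. l < Suc M) w"
  define a where "a = count_list w (Suc M)"
  have w: "w = u @ replicate a (Suc M)"
    unfolding u_def a_def by (rule sorted_split_max) (use Suc.prems in auto)
  have "sorted u" unfolding u_def by (rule sorted_wrt_filter) (rule Suc.prems(1))
  moreover have "set u = {..M}" unfolding u_def set_filter Suc.prems(2) by auto
  ultimately have u: "sorted u" "set u = {..M}" .
  have "Suc M \<in> set w" using Suc.prems(2) by simp
  then have "1 \<le> a" unfolding a_def by (metis count_list_0_iff less_one not_le)
  then consider "a = 1" | "2 \<le> a" by linarith
  then show ?case
  proof cases
    case 1
    then have "u \<noteq> [0..<Suc M]" using Suc.prems(3) w by auto
    from Suc.IH[OF u this] obtain u' j b where
      d: "sorted u'" "set u' = {..<j}" "j \<le> M" "2 \<le> b" "u = u' @ replicate b j @ [Suc j..<Suc M]" by blast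
    then have "w = u' @ replicate b j @ [Suc j..<Suc (Suc M)]" using w 1 d(3,5) by simp
    with d(1-4) show ?thesis by (intro exI[of _ u'] exI[of _ j] exI[of _ b]) simp
  next
    case 2
    have "w = u @ replicate a (Suc M) @ [Suc (Suc M)..<Suc (Suc M)]" using w by simp
    moreover have "set u = {..<Suc M}" using u(2) by (simp only: lessThan_Suc_atMost)
    ultimately show ?thesis using u(1) 2 by blast
  qed
qed

lemma count_list_replicate: "count_list (replicate a x) y = (if x = y then a else 0)"
  by (induction a) auto

lemma count_list_distinct: "distinct w \<Longrightarrow> count_list w x = (if x \<in> set w then 1 else 0)"
  by (induction w) auto

lemma distinct_omit: "distinct w \<Longrightarrow> i < length w \<Longrightarrow> w ! i \<notin> set (omit i w)"
  by (auto simp: in_set_conv_nth nth_omit nth_eq_iff_index_eq split: if_splits)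

lemma count_repeated_letter:
  assumes "set u = {..<j}"
  shows "count_list (u @ replicate a j @ [Suc j..<Suc M]) l =
    (if l < j then count_list u l else if l = j then a else if l \<le> M then 1 else 0)"
  using assms by (auto simp: count_list_replicate count_list_distinct simp del: upt_Suc)

text \<open>
  The letter \<open>j\<close> is the largest one that occurs at least twice, and \<open>a\<close> is its multiplicity.
\<close>

lemma repeated_letter_unique:
  assumes u: "set u = {..<j}" "set u' = {..<j'}" and a: "2 \<le> a" "2 \<le> a'"
    and eq: "u @ replicate a j @ [Suc j..<Suc M] = u' @ replicate a' j' @ [Suc j'..<Suc M]"
  shows "u = u' \<and> j = j' \<and> a = a'"
proof -
  have c: "(if l < j then count_list u l else if l = j then a else if l \<le> M then 1 else 0)
      = (if l < j' then count_list u' l else if l = j' then a' else if l \<le> M then 1 else 0)" for l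
    by (rule trans[OF count_repeated_letter[OF u(1), of a M l, symmetric, unfolded eq] count_repeated_letter[OF u(2)]])
  have j: "j = j'"
    using c[of j] c[of j'] a by (cases j j' rule: linorder_cases) (auto split: if_splits)
  with c[of j] have "a = a'" by simp
  with j eq show ?thesis by simp
qed

text \<open>
  The letter \<open>(l, False)\<close> stands for the vertex \<open>l\<close> and \<open>(l, True)\<close> for its copy. A word that misses a
  letter, up to marks, receives the value of the word without marks. In particular the edge from \<open>l\<close> to
  its copy has the value \<open>B [l, l]\<close>; this is what makes the outer horns fillable.
\<close>

lemma extend_over_simplex:
  assumes X: "quasi_semicategory X" and M: "1 \<le> M"
    and N: "N = {w. w \<noteq> [] \<and> sorted w \<and> set w \<subset> {..M}}"
    and B: "word_map X N B"
    and y: "y \<in> cells X M" and y_faces: "\<And>i. i \<le> M \<Longrightarrow> face X M i y = B (omit i [0..<Suc M])"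
    and eqv: "\<And>i. i \<le> M \<Longrightarrow> equivalence X (B [i, i])"
  shows "\<exists>D. word_map X {w. w \<noteq> [] \<and> sorted w \<and> set w \<subseteq> {..M}} D \<and>
    (\<forall>w\<in>N. D w = B w) \<and> D [0..<Suc M] = y"
proof -
  define tail where "tail j = [Suc j..<Suc M]" for j
  \<comment> \<open>The word \<open>u j\<^sup>a j' v\<close>. Also \<open>a = 0\<close> is used: it gives the missing face for \<open>a = 1\<close>.\<close>
  define top where "top u j a = unmarked (u @ replicate a j) @ (j, True) # unmarked (tail j)" for u j a
  define ok where "ok u j a \<longleftrightarrow> sorted u \<and> set u = {..<j} \<and> j \<le> M \<and> 1 \<le> a" for u j and a :: nat
  define P where "P = {top u j a |u j a. ok u j a}"
  \<comment> \<open>The word \<open>u j\<^sup>a j' v\<close> determines \<open>j\<close> through its mark, hence the index \<open>\<kappa>\<close> of the missing face: the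
    only occurrence of the unmarked \<open>j\<close> if \<open>a = 1\<close>, and the marked letter otherwise.\<close>
  define pos where "pos w = length (takeWhile (\<lambda>x. \<not> snd x) w)" for w :: "(nat \<times> bool) list"
  define mark where "mark w = fst (w ! pos w)" for w
  define \<kappa> where "\<kappa> w = (if count_list w (mark w, False) = 1 then pos w - 1 else pos w)" for w
  \<comment> \<open>Since \<open>mark w \<le> M\<close>, comparing ranks means comparing lengths first and marks second.\<close>
  define r where "r w = length w * Suc M + mark w" for w
  define F where "F w = (if fst ` set w = {..M} then y else B (map fst w))" for w :: "(nat \<times> bool) list"
  define T where "T = insert (unmarked [0..<Suc M]) {w. w \<noteq> [] \<and> sorted (map fst w) \<and> fst ` set w \<subset> {..M}}"

  have set_tail: "set (tail j) = {Suc j..M}" and dist_tail: "distinct (tail j)" and len_tail: "length (tail j) = M - j" for j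
    by (auto simp: tail_def simp del: upt_Suc)
  have fst_unmarked: "map fst (unmarked w) = w" for w by (simp add: comp_def)
  have pos: "pos (top u j a) = length u + a" for u j a
    by (simp add: pos_def top_def takeWhile_append)
  have mark: "mark (top u j a) = j" for u j a
    unfolding mark_def pos by (simp add: top_def nth_append)
  have unm: "count_list (unmarked w) (j, False) = count_list w j" for w j by (induction w) auto
  have "count_list (top u j a) (j, False) = a" if "ok u j a" for u j a
    using that by (simp add: top_def unm ok_def count_list_replicate count_list_distinct[OF dist_tail] set_tail)
  then have \<kappa>: "\<kappa> (top u j a) = (if a = 1 then length u else length u + a)" if "ok u j a" for u j a
    using that by (simp add: \<kappa>_def mark pos)
  have len: "length (top u j a) = length u + a + 1 + (M - j)" for u j a
    by (simp add: top_def len_tail)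
  have omit_mark: "omit (length u + a) (top u j a) = unmarked (u @ replicate a j @ tail j)" for u j a
    by (simp add: top_def omit_append omit_Cons_0)
  have omit_rep: "omit i (top u j a) = top u j (a - 1)" if i: "length u \<le> i" "i < length u + a" for u j a i
  proof -
    obtain k where "i = length u + k" using le_Suc_ex[OF i(1)] by blast
    then show ?thesis using i(2) by (simp add: top_def omit_append omit_replicate)
  qed
  have miss1: "omit (\<kappa> (top u j a)) (top u j a) = top u j 0" if "ok u j a" "a = 1" for u j a
    using that omit_rep[of u "length u" 1 j] by (simp add: \<kappa>)
  have miss2: "omit (\<kappa> (top u j a)) (top u j a) = unmarked (u @ replicate a j @ tail j)"
    if "ok u j a" "a \<noteq> 1" for u j a
    using that omit_mark[of u a j] by (simp add: \<kappa>)
  have word_sorted: "sorted (u @ replicate a j @ tail j)" if "sorted u" "set u \<subseteq> {..<j}" for u j a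
  proof -
    have "sorted (tail j)" by (simp add: tail_def del: upt_Suc)
    moreover have "x < j" if "x \<in> set u" for x using that \<open>set u \<subseteq> {..<j}\<close> by blast
    ultimately show ?thesis using \<open>sorted u\<close>
      by (fastforce simp: sorted_append set_tail)
  qed
  have letters: "map fst (top u j a) = u @ replicate (Suc a) j @ tail j" for u j a
    by (simp add: top_def comp_def replicate_append_same flip: replicate_app_Cons_same)

  have letters_full: "set (u @ replicate a j @ tail j) = {..M}" if "ok u j b" "1 \<le> a" for u j a b
  proof -
    have "set (u @ replicate a j @ tail j) = {..<j} \<union> {j} \<union> {Suc j..M}" and "j \<le> M"
      using that by (simp_all add: ok_def set_tail)
    moreover have "{..<j} \<union> {j} \<union> {Suc j..M} = {..M}" using \<open>j \<le> M\<close> by auto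
    ultimately show ?thesis by (simp only:)
  qed
  have in_T: "w \<in> T" if "w \<noteq> []" "sorted (map fst w)" "fst ` set w \<subset> {..M}" for w
    using that by (simp add: T_def)
  have T_cases: "w = unmarked [0..<Suc M]" if "w \<in> T" "fst ` set w = {..M}" for w
    using that by (auto simp: T_def)
  have marked_top: "(j, True) \<in> set (top u j a)" for u j a by (simp add: top_def)
  \<comment> \<open>The words to be filled contain a letter in both forms, whereas their missing faces do not.\<close>
  define overfull where "overfull w \<longleftrightarrow> (\<exists>j. (j, True) \<in> set w \<and> (j, False) \<in> set w)" for w :: "(nat \<times> bool) list"
  have ok_less: "x < j" if "ok u j a" "x \<in> set u" for u j a x
  proof -
    have "x \<in> {..<j}" using that unfolding ok_def by blast
    then show ?thesis by simp
  qed
  have top3: "3 \<le> length (top u j a)" if "ok u j a" for u j a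
  proof -
    have "set u = {..<j}" using that by (simp add: ok_def)
    then have "u \<noteq> [] \<or> j = 0" by (metis empty_set lessThan_empty_iff bot_nat_def)
    then have "1 \<le> length u \<or> j = 0" by (cases u) simp_all
    with that M show ?thesis unfolding ok_def len by linarith
  qed
  have over_top: "overfull (top u j a)" if "ok u j a" for u j a
    using that unfolding ok_def by (simp add: overfull_def top_def image_iff)
  have not_over: "\<not> overfull (omit (\<kappa> w) w)" and miss_new: "omit (\<kappa> w) w \<notin> T" if wP: "w \<in> P" for w
  proof -
    obtain u j a where w: "w = top u j a" and o: "ok u j a" using wP unfolding P_def by blast
    have "\<not> overfull (omit (\<kappa> w) w) \<and> omit (\<kappa> w) w \<notin> T"
    proof (cases "a = 1")
      case True
      have "\<not> overfull (top u j 0)" by (auto simp: overfull_def top_def set_tail dest: ok_less[OF o])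
      moreover have "top u j 0 \<notin> T"
      proof
        assume "top u j 0 \<in> T"
        moreover have "fst ` set (top u j 0) = {..M}"
          unfolding set_map[symmetric] letters using letters_full[OF o, of "Suc 0"] by simp
        ultimately have "top u j 0 = unmarked [0..<Suc M]" by (rule T_cases)
        then show False using marked_top[of j u 0] by auto
      qed
      ultimately show ?thesis using miss1[OF o True] True by (simp add: w)
    next
      case False
      let ?l = "u @ replicate a j @ tail j"
      have a: "2 \<le> a" using False o by (simp add: ok_def)
      have "unmarked ?l \<notin> T"
      proof
        assume "unmarked ?l \<in> T"
        moreover have "fst ` set (unmarked ?l) = {..M}"
          unfolding set_map[symmetric] fst_unmarked using letters_full[OF o, of a] a by simp
        ultimately have "unmarked ?l = unmarked [0..<Suc M]" by (rule T_cases)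
        then have "?l = [0..<Suc M]" by (metis fst_unmarked)
        then have "count_list ?l j \<le> 1" by (simp only: count_list_distinct[OF distinct_upt]) simp
        moreover have "count_list ?l j = a"
          using o count_repeated_letter[of u j a M j] by (simp add: ok_def tail_def)
        ultimately show False using a by simp
      qed
      moreover have "\<not> overfull (unmarked ?l)" by (auto simp: overfull_def)
      ultimately show ?thesis using miss2[OF o False] by (simp add: w)
    qed
    then show "\<not> overfull (omit (\<kappa> w) w)" "omit (\<kappa> w) w \<notin> T" by auto
  qed
  have miss_inj: "inj_on (\<lambda>w. omit (\<kappa> w) w) P"
  proof (rule inj_onI)
    fix w w' assume "w \<in> P" "w' \<in> P" and eq: "omit (\<kappa> w) w = omit (\<kappa> w') w'"
    then obtain u j a u' j' a' where w: "w = top u j a" "w' = top u' j' a'"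
      and o: "ok u j a" "ok u' j' a'" by (auto simp: P_def)
    have nm: "top u j a \<noteq> unmarked v" for u j a v using marked_top[of j u a] by auto
    consider "a = 1" "a' = 1" | "a = 1" "a' \<noteq> 1" | "a \<noteq> 1" "a' = 1" | "a \<noteq> 1" "a' \<noteq> 1" by blast
    then show "w = w'"
    proof cases
      case 1
      with eq have e: "top u j 0 = top u' j' 0" using miss1[OF o(1)] miss1[OF o(2)] by (simp add: w)
      have j: "j = j'" using arg_cong[OF e, of mark] unfolding mark .
      have "u = u'" using arg_cong[OF e, of "map fst"] unfolding letters j by simp
      with j show ?thesis using 1 by (simp add: w)
    next
      case 2
      then have False using eq nm[of u j 0] unfolding w miss1[OF o(1) 2(1)] miss2[OF o(2) 2(2)] by blast
      then show ?thesis ..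
    next
      case 3
      then have False using eq[symmetric] nm[of u' j' 0]
        unfolding w miss2[OF o(1) 3(1)] miss1[OF o(2) 3(2)] by blast
      then show ?thesis ..
    next
      case 4
      have "unmarked (u @ replicate a j @ tail j) = unmarked (u' @ replicate a' j' @ tail j')"
        using eq unfolding w miss2[OF o(1) 4(1)] miss2[OF o(2) 4(2)] .
      from arg_cong[OF this, of "map fst"]
      have "u @ replicate a j @ tail j = u' @ replicate a' j' @ tail j'" unfolding fst_unmarked .
      moreover have "2 \<le> a" "2 \<le> a'" "set u = {..<j}" "set u' = {..<j'}" using o 4 by (simp_all add: ok_def)
      ultimately have "u = u' \<and> j = j' \<and> a = a'"
        unfolding tail_def by (intro repeated_letter_unique)
      then show ?thesis by (simp add: w)
    qed
  qed

  have full_word: "unmarked v \<in> T \<or> (\<exists>u j a. ok u j a \<and> a \<noteq> 1 \<and> v = u @ replicate a j @ tail j)"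
    if "sorted v" "set v = {..M}" for v
  proof (cases "v = [0..<Suc M]")
    case False
    from repeated_letter_decomposition[OF that False] obtain u j a where
      "sorted u" "set u = {..<j}" "j \<le> M" "2 \<le> a" "v = u @ replicate a j @ tail j"
      unfolding tail_def by blast
    then show ?thesis by (intro disjI2 exI[of _ u] exI[of _ j] exI[of _ a]) (simp add: ok_def)
  qed (simp add: T_def)

  \<comment> \<open>The face \<open>i\<close> is formed by omitting a letter of \<open>u\<close>, one of several \<open>j\<close>, the mark, or a letter of \<open>v\<close>.
    Omitting a letter that occurs only once leads into \<open>T\<close>. Omitting the mark matters only if \<open>a = 1\<close>; then
    the face \<open>u j v\<close> is either \<open>01\<dots>M\<close> or the missing face of a word of the same length with a smaller mark.\<close>
  have faces: "omit i w \<in> T \<or> (\<exists>v\<in>P. r v < r w \<and> (omit i w = v \<or> omit i w = omit (\<kappa> v) v))"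
    if wP: "w \<in> P" and il: "i < length w" "i \<noteq> \<kappa> w" for w i
  proof -
    obtain u j a where w: "w = top u j a" and o: "ok u j a" using wP unfolding P_def by blast
    have \<kappa>w: "\<kappa> w = (if a = 1 then length u else length u + a)" unfolding w by (rule \<kappa>[OF o])
    have sw: "sorted (map fst w)" unfolding w letters using o by (intro word_sorted) (auto simp: ok_def)
    have "fst ` set (omit i w) \<subseteq> {..M}"
      using set_omit[of i w] letters_full[OF o, of "Suc a"] arg_cong[OF letters[of u j a], of set]
      by (auto simp: w)
    moreover have so: "sorted (map fst (omit i w))"
      unfolding map_omit using il(1) sw by (intro sorted_omit) simp
    moreover have "omit i w \<noteq> []" using il(1) length_omit[of i w] top3[OF o] by (auto simp: w simp del: length_omit)
    ultimately have nonfull: "omit i w \<in> T" if "l \<le> M" "l \<notin> set (map fst (omit i w))" for l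
      using that by (intro in_T) auto
    have lo: "length (omit i w) < length w" using il(1) by simp
    have lower: ?thesis if "omit i w = top u' j a'" "ok u' j a'" for u' a'
    proof -
      have "r (omit i w) < r w" using mult_less_mono1[OF lo zero_less_Suc[of M]] that(1) unfolding r_def w
        by (simp add: mark del: length_omit mult_Suc_right)
      then show ?thesis using that by (auto simp: P_def)
    qed
    have i: "i < length u + a + 1 + (M - j)" using il(1) by (simp add: w len)
    consider "i < length u" | "length u \<le> i" "i < length u + a" | "i = length u + a"
      | k where "i = length u + a + 1 + k" "k < M - j"
    proof (cases "i \<le> length u + a")
      case False
      then show ?thesis using i by (intro that(4)[of "i - (length u + a + 1)"]) auto
    qed (use that in linarith)
    then show ?thesis
    proof cases
      case 1
      then have e: "omit i w = top (omit i u) j a" by (simp add: w top_def omit_append map_omit)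
      show ?thesis
      proof (cases "set (omit i u) = {..<j}")
        case True
        with o 1 have "ok (omit i u) j a" by (simp add: ok_def sorted_omit)
        with e show ?thesis by (rule lower)
      next
        case False
        then obtain l where l: "l < j" "l \<notin> set (omit i u)"
          using set_omit[of i u] o by (auto simp: ok_def)
        then have "l \<notin> set (map fst (omit i w))" unfolding e letters by (simp add: set_tail)
        then show ?thesis using nonfull[of l] l o by (simp add: ok_def)
      qed
    next
      case 2
      then have "a \<noteq> 1" using il(2) unfolding \<kappa>w by (simp split: if_splits)
      then have "1 \<le> a - 1" using o unfolding ok_def by linarith
      with o have "ok u j (a - 1)" unfolding ok_def by blast
      moreover have "omit i w = top u j (a - 1)" unfolding w by (rule omit_rep[OF 2])
      ultimately show ?thesis by (intro lower)
    next
      case 3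
      then have a: "a = 1" using il(2) unfolding \<kappa>w by (simp split: if_splits)
      have e: "omit i w = unmarked (u @ replicate 1 j @ tail j)" using omit_mark[of u 1 j] by (simp add: w 3 a)
      let ?v = "u @ replicate 1 j @ tail j"
      have "sorted ?v" using o by (intro word_sorted) (auto simp: ok_def)
      moreover have "set ?v = {..M}" using o by (intro letters_full) auto
      ultimately consider "unmarked ?v \<in> T" | u' j' a' where "ok u' j' a'" "a' \<noteq> 1" "?v = u' @ replicate a' j' @ tail j'"
        using full_word by blast
      then show ?thesis
      proof cases
        case 2
        have "j' < j"
        proof (rule ccontr)
          \<comment> \<open>In \<open>u j v\<close> no letter from \<open>j\<close> on is repeated.\<close>
          assume "\<not> j' < j"
          then have "count_list ?v j' \<le> 1"
            using o count_repeated_letter[of u j 1 M j'] by (simp add: ok_def tail_def)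
          moreover have "count_list ?v j' = a'" unfolding 2(3)
            using 2(1) count_repeated_letter[of u' j' a' M j'] by (simp add: ok_def tail_def)
          ultimately show False using 2(1,2) by (simp add: ok_def)
        qed
        moreover have "omit i w = omit (\<kappa> (top u' j' a')) (top u' j' a')"
          unfolding e 2(3) miss2[OF 2(1,2)] ..
        moreover have "length (top u' j' a') = length w"
          using arg_cong[OF 2(3), of length] by (simp add: len w a len_tail)
        ultimately show ?thesis
          using 2(1) by (intro disjI2 bexI[of _ "top u' j' a'"]) (auto simp: P_def r_def w mark)
      qed (simp add: e)
    next
      case 4
      have e: "omit i w = unmarked (u @ replicate a j) @ (j, True) # unmarked (omit k (tail j))"
        using 4 by (simp add: w top_def omit_append map_omit) (simp add: omit_def)
      have l: "tail j ! k = Suc j + k" using 4 by (simp add: tail_def del: upt_Suc)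
      have "tail j ! k \<notin> set (omit k (tail j))"
        using 4 by (intro distinct_omit) (simp_all add: dist_tail len_tail)
      then have "Suc j + k \<notin> set (map fst (omit i w))" using o by (simp add: e l ok_def comp_def)
      then show ?thesis using nonfull[of "Suc j + k"] 4 by simp
    qed
  qed

  have T_closed: "face_closed T"
    unfolding face_closed_def
  proof (intro ballI conjI impI allI)
    fix w assume w: "w \<in> T"
    show "w \<noteq> []" using w by (auto simp: T_def simp del: upt_Suc)
    fix i assume i: "2 \<le> length w" "i < length w"
    have ne: "omit i w \<noteq> []" using i length_omit[of i w] by (auto simp del: length_omit)
    have "sorted (map fst w)" using w by (auto simp: T_def comp_def simp del: upt_Suc)
    then have so: "sorted (map fst (omit i w))" unfolding map_omit using i(2) by (intro sorted_omit) simp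
    have sub: "fst ` set (omit i w) \<subseteq> fst ` set w" using set_omit by (intro image_mono)
    show "omit i w \<in> T"
    proof (cases "w = unmarked [0..<Suc M]")
      case True
      have "[0..<Suc M] ! i \<notin> set (omit i [0..<Suc M])"
        using i True by (intro distinct_omit) (simp_all del: upt_Suc)
      then have "i \<notin> fst ` set (omit i w)" "i \<le> M"
        using i unfolding True by (simp_all add: comp_def flip: map_omit set_map del: upt_Suc)
      moreover have "fst ` set w = {..M}" by (auto simp: True image_image simp del: upt_Suc)
      ultimately have "fst ` set (omit i w) \<subset> {..M}" using sub by blast
      with ne so show ?thesis by (rule in_T)
    next
      case False
      then have "fst ` set w \<subset> {..M}" using w by (simp add: T_def)
      with sub have "fst ` set (omit i w) \<subset> {..M}" by blast
      with ne so show ?thesis by (rule in_T)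
    qed
  qed
  have F_nonfull: "F w = B (map fst w)" if "fst ` set w \<subset> {..M}" for w
    using that by (auto simp: F_def)
  have full_set: "fst ` set (unmarked [0..<Suc M]) = {..M}" by (auto simp: image_image simp del: upt_Suc)
  have F_full: "F (unmarked [0..<Suc M]) = y" using full_set by (simp add: F_def del: upt_Suc)
  have T_word_map: "word_map X T F"
    unfolding word_map_def
  proof (intro ballI)
    fix w assume w: "w \<in> T"
    show "F w \<in> cells X (length w - 1) \<and>
      (2 \<le> length w \<longrightarrow> (\<forall>i<length w. face X (length w - 1) i (F w) = F (omit i w)))"
    proof (cases "w = unmarked [0..<Suc M]")
      case True
      have "face X M i y = F (omit i w)" if "i \<le> M" for i
      proof -
        have "omit i w \<in> T" using that M True by (intro face_closed_omit[OF T_closed w]) simp_all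
        moreover have "omit i w \<noteq> unmarked [0..<Suc M]"
        proof
          assume "omit i w = unmarked [0..<Suc M]"
          from arg_cong[OF this, of length] show False using that True by simp
        qed
        ultimately have "fst ` set (omit i w) \<subset> {..M}" using T_cases by (auto simp: T_def)
        from F_nonfull[OF this] have "F (omit i w) = B (omit i (map fst w))" unfolding map_omit .
        also have "map fst w = [0..<Suc M]" unfolding True fst_unmarked ..
        finally show ?thesis using y_faces[OF that] by simp
      qed
      with y show ?thesis unfolding True F_full by (simp add: less_Suc_eq_le del: upt_Suc)
    next
      case False
      with w have w': "fst ` set w \<subset> {..M}" "w \<noteq> []" "sorted (map fst w)" by (auto simp: T_def)
      then have "map fst w \<in> N" by (simp add: N)
      then have "B (map fst w) \<in> cells X (length w - 1)"
        "\<And>i. 2 \<le> length w \<Longrightarrow> i < length w \<Longrightarrow> face X (length w - 1) i (B (map fst w)) = B (omit i (map fst w))"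
        using B unfolding word_map_def by auto
      moreover have "fst ` set (omit i w) \<subset> {..M}" for i
        using w'(1) image_mono[OF set_omit[of i w], of fst] by blast
      ultimately show ?thesis using w'(1) by (simp add: F_nonfull map_omit)
    qed
  qed
  have edge: "[(l, False), (l, True)] \<in> T \<and> equivalence X (F [(l, False), (l, True)])" if "l \<le> M" for l
  proof -
    have "{l} \<subset> {..M}" using that M by (cases "l = 0") auto
    then show ?thesis using eqv[OF that] by (simp add: T_def F_nonfull)
  qed
  have "\<exists>F'. word_map X (T \<union> P \<union> (\<lambda>w. omit (\<kappa> w) w) ` P) F' \<and> (\<forall>w\<in>T. F' w = F w)"
  proof (rule fill_ranked[OF X T_closed T_word_map, where r = r])
    fix w assume wP: "w \<in> P"
    then obtain u j a where w: "w = top u j a" and o: "ok u j a" unfolding P_def by blast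
    have \<kappa>w: "\<kappa> w = (if a = 1 then length u else length u + a)" unfolding w by (rule \<kappa>[OF o])
    have a: "1 \<le> a" and j: "j \<le> M" using o by (simp_all add: ok_def)
    show "3 \<le> length w \<and> \<kappa> w < length w"
      using top3[OF o] unfolding \<kappa>w by (simp add: w len)
    show "omit (\<kappa> w) w \<notin> T" by (rule miss_new[OF wP])
    show "omit i w \<in> T \<or> (\<exists>v\<in>P. r v < r w \<and> (omit i w = v \<or> omit i w = omit (\<kappa> v) v))"
      if "i < length w" "i \<noteq> \<kappa> w" for i by (rule faces[OF wP that])
    show "[w ! 0, w ! 1] \<in> T \<and> equivalence X (F [w ! 0, w ! 1])" if "\<kappa> w = 0"
    proof -
      have "a = 1" "u = []" using that a unfolding \<kappa>w by (simp_all split: if_splits)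
      then show ?thesis using edge[OF j] by (simp add: w top_def)
    qed
    show "[w ! (\<kappa> w - 1), w ! \<kappa> w] \<in> T \<and> equivalence X (F [w ! (\<kappa> w - 1), w ! \<kappa> w])"
      if "Suc (\<kappa> w) = length w"
    proof -
      have "a \<noteq> 1" using that unfolding \<kappa>w by (auto simp: w len)
      then have k: "\<kappa> w = length u + a" "\<kappa> w - 1 = length u + (a - 1)" using a by (simp_all add: \<kappa>w)
      have "w ! (length u + (a - 1)) = (j, False)" "w ! (length u + a) = (j, True)"
      proof -
        obtain b where "a = Suc b" using a by (cases a) auto
        then show "w ! (length u + (a - 1)) = (j, False)" "w ! (length u + a) = (j, True)"
          by (simp_all add: w top_def nth_append del: replicate_Suc)
      qed
      then show ?thesis unfolding k(2) unfolding k(1) using edge[OF j] by (simp only:)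
    qed
  next
    show "(\<lambda>w. omit (\<kappa> w) w) ` P \<inter> P = {}"
    proof -
      have False if w: "w \<in> P" "omit (\<kappa> w) w \<in> P" for w
      proof -
        obtain u j a where e: "omit (\<kappa> w) w = top u j a" and o: "ok u j a"
          using w(2) unfolding P_def by blast
        show False using not_over[OF w(1)] over_top[OF o] unfolding e by blast
      qed
      then show ?thesis by blast
    qed
    show "inj_on (\<lambda>w. omit (\<kappa> w) w) P" by (rule miss_inj)
  qed
  then obtain F' where F': "word_map X (T \<union> P \<union> (\<lambda>w. omit (\<kappa> w) w) ` P) F'"
    and FF: "\<And>w. w \<in> T \<Longrightarrow> F' w = F w" by blast
  have mem: "unmarked w \<in> T \<union> P \<union> (\<lambda>w. omit (\<kappa> w) w) ` P"
    if "w \<noteq> []" "sorted w" "set w \<subseteq> {..M}" for w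
  proof (cases "set w = {..M}")
    case True
    from full_word[OF that(2) True] show ?thesis
    proof
      assume "\<exists>u j a. ok u j a \<and> a \<noteq> 1 \<and> w = u @ replicate a j @ tail j"
      then obtain u j a where o: "ok u j a" "a \<noteq> 1" and w: "w = u @ replicate a j @ tail j" by blast
      have "unmarked w = omit (\<kappa> (top u j a)) (top u j a)" unfolding miss2[OF o] w ..
      moreover have "top u j a \<in> P" using o unfolding P_def by blast
      ultimately show ?thesis by blast
    qed blast
  next
    case False
    have "unmarked w \<in> T" using that False by (intro in_T) (auto simp: comp_def image_image)
    then show ?thesis by blast
  qed
  define D where "D w = F' (unmarked w)" for w
  have "word_map X {w. w \<noteq> [] \<and> sorted w \<and> set w \<subseteq> {..M}} D"
    unfolding word_map_def
  proof (intro ballI)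
    fix w assume "w \<in> {w. w \<noteq> [] \<and> sorted w \<and> set w \<subseteq> {..M}}"
    then have "unmarked w \<in> T \<union> P \<union> (\<lambda>w. omit (\<kappa> w) w) ` P" using mem by simp
    from bspec[OF F'[unfolded word_map_def] this]
    show "D w \<in> cells X (length w - 1) \<and>
      (2 \<le> length w \<longrightarrow> (\<forall>i<length w. face X (length w - 1) i (D w) = D (omit i w)))"
      unfolding D_def map_omit length_map .
  qed
  moreover have "D w = B w" if "w \<in> N" for w
  proof -
    have *: "w \<noteq> []" "sorted w" "fst ` set (unmarked w) \<subset> {..M}" using that by (auto simp: N image_image)
    then have "unmarked w \<in> T" by (intro in_T) (simp_all add: comp_def)
    then show ?thesis using F_nonfull[OF *(3)] by (simp only: D_def FF fst_unmarked)
  qed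
  moreover have "D [0..<Suc M] = y" unfolding D_def using F_full by (simp add: FF T_def del: upt_Suc)
  ultimately show ?thesis by blast
qed

section \<open>Acting on the cells of one more dimension\<close>

text \<open>
  The part of a simplicial structure that consists of the pullbacks of cells of dimension less than \<open>M\<close>.
  For \<open>\<tau>: [n] \<rightarrow> [m]\<close> and \<open>\<rho>: [k] \<rightarrow> [n]\<close> the equation \<open>(\<tau>\<rho>)\<^sup>*x = \<rho>\<^sup>*(\<tau>\<^sup>*x)\<close> makes sense only if also
  \<open>n < M\<close>; but if \<open>\<rho>\<close> is injective, then \<open>\<rho>\<^sup>*\<close> is given by \<open>X\<close> and the equation can be demanded for
  every \<open>n\<close>.
\<close>

definition partial_structure ::
    "'a presheaf \<Rightarrow> ('a \<Rightarrow> 'a) \<Rightarrow> nat \<Rightarrow> (nat \<Rightarrow> nat \<Rightarrow> (nat \<Rightarrow> nat) \<Rightarrow> 'a \<Rightarrow> 'a) \<Rightarrow> bool" where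
  "partial_structure X s M A \<longleftrightarrow>
    (\<forall>m<M. \<forall>n. \<forall>\<tau>\<in>delta_maps n m. \<forall>x\<in>cells X m. A n m \<tau> x \<in> cells X n) \<and>
    (\<forall>m<M. \<forall>n. \<forall>\<tau>\<in>delta_inj_maps n m. \<forall>x\<in>cells X m. A n m \<tau> x = act X n m \<tau> x) \<and>
    (\<forall>m<M. \<forall>n<M. \<forall>k. \<forall>\<tau>\<in>delta_maps n m. \<forall>\<rho>\<in>delta_maps k n. \<forall>x\<in>cells X m.
      A k m (delta_comp k \<tau> \<rho>) x = A k n \<rho> (A n m \<tau> x)) \<and>
    (\<forall>m<M. \<forall>n k. \<forall>\<tau>\<in>delta_maps n m. \<forall>\<rho>\<in>delta_inj_maps k n. \<forall>x\<in>cells X m.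
      A k m (delta_comp k \<tau> \<rho>) x = act X k n \<rho> (A n m \<tau> x)) \<and>
    (0 < M \<longrightarrow> (\<forall>x\<in>cells X 0. A 1 0 (codegeneracy 0 0) x = s x))"

lemma partial_structure_cells:
  assumes "partial_structure X s M A" "m < M" "x \<in> cells X m" "\<tau> \<in> delta_maps n m"
  shows "A n m \<tau> x \<in> cells X n"
  using assms(1)[unfolded partial_structure_def, THEN conjunct1] assms(2-4) by simp

lemma partial_structure_inj:
  assumes "partial_structure X s M A" "m < M" "x \<in> cells X m" "\<tau> \<in> delta_inj_maps n m"
  shows "A n m \<tau> x = act X n m \<tau> x"
  using assms(1)[unfolded partial_structure_def, THEN conjunct2, THEN conjunct1] assms(2-4) by simp

lemma partial_structure_comp:
  assumes "partial_structure X s M A" "m < M" "x \<in> cells X m" "n < M" "\<tau> \<in> delta_maps n m" "\<rho> \<in> delta_maps k n"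
  shows "A k m (delta_comp k \<tau> \<rho>) x = A k n \<rho> (A n m \<tau> x)"
  using assms(1)[unfolded partial_structure_def, THEN conjunct2, THEN conjunct2, THEN conjunct1,
      rule_format, OF assms(2,4,5,6,3)] .

lemma partial_structure_act:
  assumes "partial_structure X s M A" "m < M" "x \<in> cells X m" "\<tau> \<in> delta_maps n m" "\<rho> \<in> delta_inj_maps k n"
  shows "A k m (delta_comp k \<tau> \<rho>) x = act X k n \<rho> (A n m \<tau> x)"
  using assms(1)[unfolded partial_structure_def, THEN conjunct2, THEN conjunct2, THEN conjunct2,
      THEN conjunct1, rule_format, OF assms(2,4,5,3)] .

lemma partial_structure_unit:
  "partial_structure X s M A \<Longrightarrow> 0 < M \<Longrightarrow> x \<in> cells X 0 \<Longrightarrow> A 1 0 (codegeneracy 0 0) x = s x"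
  unfolding partial_structure_def by simp

text \<open>
  What the pullbacks \<open>D n \<tau> = \<tau>\<^sup>*y\<close> of one \<open>M\<close>-cell \<open>y\<close> must satisfy to extend a partial structure \<open>A\<close>:
  they have to be compatible with faces, to agree with \<open>A\<close> on the faces of \<open>y\<close>, to agree with \<open>A\<close> if \<open>y\<close>
  is itself a pullback of a lower cell, and to give the prescribed edge on a vertex.
\<close>

definition cell_action ::
    "'a presheaf \<Rightarrow> ('a \<Rightarrow> 'a) \<Rightarrow> nat \<Rightarrow> (nat \<Rightarrow> nat \<Rightarrow> (nat \<Rightarrow> nat) \<Rightarrow> 'a \<Rightarrow> 'a) \<Rightarrow> 'a
      \<Rightarrow> (nat \<Rightarrow> (nat \<Rightarrow> nat) \<Rightarrow> 'a) \<Rightarrow> bool" where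
  "cell_action X s M A y D \<longleftrightarrow>
    (\<forall>n. \<forall>\<tau>\<in>delta_maps n M. D n \<tau> \<in> cells X n) \<and>
    D M (delta_id M) = y \<and>
    (\<forall>n k. \<forall>\<tau>\<in>delta_maps n M. \<forall>\<rho>\<in>delta_inj_maps k n. D k (delta_comp k \<tau> \<rho>) = act X k n \<rho> (D n \<tau>)) \<and>
    (1 \<le> M \<longrightarrow> (\<forall>j\<le>M. \<forall>n. \<forall>\<epsilon>\<in>delta_maps n (M - 1).
      D n (delta_comp n (coface M j) \<epsilon>) = A n (M - 1) \<epsilon> (face X M j y))) \<and>
    (\<forall>m<M. \<forall>\<sigma>\<in>delta_maps M m. \<forall>x\<in>cells X m. A M m \<sigma> x = y \<longrightarrow>
      (\<forall>k. \<forall>\<rho>\<in>delta_maps k M. D k \<rho> = A k m (delta_comp k \<sigma> \<rho>) x)) \<and>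
    (M = 0 \<longrightarrow> D 1 (codegeneracy 0 0) = s y)"

context
  fixes X :: "'a presheaf" and s :: "'a \<Rightarrow> 'a" and M :: nat
    and A :: "nat \<Rightarrow> nat \<Rightarrow> (nat \<Rightarrow> nat) \<Rightarrow> 'a \<Rightarrow> 'a" and y :: 'a
  assumes X: "quasi_semicategory X" and A: "partial_structure X s M A" and y: "y \<in> cells X M"
begin

lemma semi: "semisimplicial_set X" using X by (simp add: quasi_semicategory_def)

text \<open>
  Two ways of writing a word as a word in a face of \<open>y\<close> come from a word in a face of codimension two,
  to which the partial structure restricts consistently.
\<close>

lemma lower_faces_agree:
  assumes M: "1 \<le> M" and \<epsilon>: "\<epsilon> \<in> delta_maps n (M - 1)" "\<epsilon>' \<in> delta_maps n (M - 1)" and j: "j \<le> M" "j' \<le> M"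
    and eq: "delta_comp n (coface M j) \<epsilon> = delta_comp n (coface M j') \<epsilon>'"
  shows "A n (M - 1) \<epsilon> (face X M j y) = A n (M - 1) \<epsilon>' (face X M j' y)"
  using \<epsilon> j eq
proof (induction j j' arbitrary: \<epsilon> \<epsilon>' rule: linorder_wlog)
  case (le j j')
  show ?case
  proof (cases "j = j'")
    case True
    then have "\<epsilon> = \<epsilon>'" using coface_cancel[OF M] le by simp
    with True show ?thesis by simp
  next
    case False
    then have "j < j'" using le by simp
    from factor_through_two_cofaces[OF le(2,3) this le(5,6)] obtain \<rho> where
      M2: "2 \<le> M" and \<rho>: "\<rho> \<in> delta_maps n (M - 2)"
      and e: "\<epsilon> = delta_comp n (coface (M - 1) (j' - 1)) \<rho>" "\<epsilon>' = delta_comp n (coface (M - 1) j) \<rho>" .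
    have c: "coface (M - 1) l \<in> delta_inj_maps (M - 2) (M - 1)" if "l \<le> M - 1" for l
      using coface_in[of "M-1" l] that M2 by (simp add: numeral_2_eq_2)
    have f: "A n (M - 1) (delta_comp n (coface (M - 1) l) \<rho>) (face X M i y) = A n (M - 2) \<rho> (face X (M - 1) l (face X M i y))"
      if "l \<le> M - 1" "i \<le> M" for l i
    proof -
      have z: "face X M i y \<in> cells X (M - 1)" using face_in_cells[OF semi M that(2) y] .
      have "A n (M - 1) (delta_comp n (coface (M - 1) l) \<rho>) (face X M i y)
        = A n (M - 2) \<rho> (A (M - 2) (M - 1) (coface (M - 1) l) (face X M i y))"
        using M2 by (intro partial_structure_comp[OF A _ z _ delta_inj_mapsD[OF c[OF that(1)]] \<rho>]) auto
      also have "A (M - 2) (M - 1) (coface (M - 1) l) (face X M i y) = face X (M - 1) l (face X M i y)"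
        using partial_structure_inj[OF A _ z c[OF that(1)]] M2 by (simp add: face_def numeral_2_eq_2)
      finally show ?thesis .
    qed
    have "j' - 1 \<le> M - 1" "j \<le> M - 1" using le \<open>j < j'\<close> by auto
    then show ?thesis
      using f[of "j' - 1" j] f[of j j'] le(4,5) face_face[OF semi \<open>j < j'\<close> le(5) M2 y] by (simp add: e)
  qed
next
  case (sym j j')
  then show ?case by metis
qed

lemma drop_omitted_vertex:
  assumes m: "m < M" and \<sigma>: "\<sigma> \<in> delta_maps n m" and x: "x \<in> cells X m" and j: "j \<le> m" "j \<notin> \<sigma> ` {0..n}"
  obtains \<sigma>' where "1 \<le> m" "\<sigma>' \<in> delta_maps n (m - 1)" "face X m j x \<in> cells X (m - 1)"
    "\<forall>k. \<forall>\<rho>\<in>delta_maps k n. A k m (delta_comp k \<sigma> \<rho>) x = A k (m - 1) (delta_comp k \<sigma>' \<rho>) (face X m j x)"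
proof -
  obtain \<sigma>' where m1: "1 \<le> m" and \<sigma>': "\<sigma>' \<in> delta_maps n (m - 1)" and e: "\<sigma> = delta_comp n (coface m j) \<sigma>'"
    using factor_through_coface[OF \<sigma> j] .
  have c: "coface m j \<in> delta_inj_maps (m - 1) m" using coface_in[OF m1 j(1)] .
  have "A k m (delta_comp k \<sigma> \<rho>) x = A k (m - 1) (delta_comp k \<sigma>' \<rho>) (face X m j x)"
    if \<rho>: "\<rho> \<in> delta_maps k n" for k \<rho>
  proof -
    have "delta_comp k \<sigma> \<rho> = delta_comp k (coface m j) (delta_comp k \<sigma>' \<rho>)"
      unfolding e by (rule delta_comp_assoc[OF \<rho>, symmetric])
    then have "A k m (delta_comp k \<sigma> \<rho>) x = A k (m - 1) (delta_comp k \<sigma>' \<rho>) (A (m - 1) m (coface m j) x)"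
      using partial_structure_comp[OF A m x _ delta_inj_mapsD[OF c] delta_comp_in[OF \<rho> \<sigma>']] m by simp
    also have "A (m - 1) m (coface m j) x = face X m j x"
      using partial_structure_inj[OF A m x c] by (simp add: face_def)
    finally show ?thesis .
  qed
  then show ?thesis using that[OF m1 \<sigma>' face_in_cells[OF semi m1 j(1) x]] by blast
qed

definition presents :: "nat \<Rightarrow> (nat \<Rightarrow> nat) \<Rightarrow> 'a \<Rightarrow> bool" where
  "presents m \<sigma> x \<longleftrightarrow> m < M \<and> \<sigma> \<in> delta_maps M m \<and> x \<in> cells X m \<and> A M m \<sigma> x = y"

lemma presents_drop:
  assumes p: "presents m \<sigma> x" and j: "j \<le> m" "j \<notin> \<sigma> ` {0..M}"
  obtains \<sigma>' x' where "1 \<le> m" "presents (m - 1) \<sigma>' x'"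
    "\<forall>k. \<forall>\<rho>\<in>delta_maps k M. A k m (delta_comp k \<sigma> \<rho>) x = A k (m - 1) (delta_comp k \<sigma>' \<rho>) x'"
proof -
  have P: "m < M" "\<sigma> \<in> delta_maps M m" "x \<in> cells X m" "A M m \<sigma> x = y" using p by (auto simp: presents_def)
  obtain \<sigma>' where s: "1 \<le> m" "\<sigma>' \<in> delta_maps M (m - 1)" "face X m j x \<in> cells X (m - 1)"
    "\<forall>k. \<forall>\<rho>\<in>delta_maps k M. A k m (delta_comp k \<sigma> \<rho>) x = A k (m - 1) (delta_comp k \<sigma>' \<rho>) (face X m j x)"
    using drop_omitted_vertex[OF P(1-3) j] .
  have "A M (m - 1) \<sigma>' (face X m j x) = y"
    using bspec[OF spec[OF s(4)] delta_inj_mapsD[OF delta_id_in]] P(2,4) s(2) by simp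
  then have "presents (m - 1) \<sigma>' (face X m j x)" using P(1) s(2,3) by (simp add: presents_def)
  with s(1) show ?thesis using s(4) by (rule that)
qed

lemma minimal_presentation_surj:
  assumes p: "presents m \<sigma> x" and min: "\<And>m' \<sigma>' x'. presents m' \<sigma>' x' \<Longrightarrow> m \<le> m'"
  shows "{0..m} \<subseteq> \<sigma> ` {0..M}"
proof (rule ccontr)
  assume "\<not> {0..m} \<subseteq> \<sigma> ` {0..M}"
  then obtain j where "j \<le> m" "j \<notin> \<sigma> ` {0..M}" by (meson atLeastAtMost_iff subsetI)
  from presents_drop[OF p this] obtain \<sigma>' x' where "1 \<le> m" "presents (m - 1) \<sigma>' x'" by metis
  with min[of "m - 1" \<sigma>' x'] show False by simp
qed

text \<open>
  If \<open>\<theta>\<close> were not surjective, then \<open>y = (\<theta>\<sigma>)\<^sup>*x\<close> would factor through a proper face of \<open>x\<close>,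
  against minimality.
\<close>

lemma minimal_presentation_endo:
  assumes p: "presents m \<sigma> x" and min: "\<And>m' \<sigma>' x'. presents m' \<sigma>' x' \<Longrightarrow> m \<le> m'"
    and \<theta>: "\<theta> \<in> delta_maps m m" and fixed: "A m m \<theta> x = x"
  shows "\<theta> = delta_id m"
proof (rule delta_surj_endo[OF \<theta>], rule ccontr)
  have P: "m < M" "\<sigma> \<in> delta_maps M m" "x \<in> cells X m" "A M m \<sigma> x = y" using p by (auto simp: presents_def)
  have "A M m (delta_comp M \<theta> \<sigma>) x = y"
    using partial_structure_comp[OF A P(1,3,1) \<theta> P(2)] fixed P(4) by simp
  then have p': "presents m (delta_comp M \<theta> \<sigma>) x"
    using P(1,3) delta_comp_in[OF P(2) \<theta>] by (simp add: presents_def)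
  assume "\<not> {0..m} \<subseteq> \<theta> ` {0..m}"
  then obtain j where j: "j \<le> m" "j \<notin> \<theta> ` {0..m}" by (meson atLeastAtMost_iff subsetI)
  have "(delta_comp M \<theta> \<sigma>) ` {0..M} \<subseteq> \<theta> ` {0..m}"
    using delta_maps_le[OF P(2)] by (auto intro!: imageI)
  moreover have "j \<in> delta_comp M \<theta> \<sigma> ` {0..M}"
    by (rule subsetD[OF minimal_presentation_surj[OF p']]) (rule min, assumption, simp add: j)
  ultimately show False using j(2) by blast
qed

text \<open>
  Reduce to surjective \<open>\<sigma>'\<close> by passing to faces of \<open>x'\<close>. A section \<open>\<delta>\<close> of \<open>\<sigma>'\<close> then recovers
  \<open>x' = \<delta>\<^sup>*y = (\<sigma>\<delta>)\<^sup>*x\<close>, so that \<open>(\<sigma>'\<rho>)\<^sup>*x' = (\<sigma>\<delta>\<sigma>'\<rho>)\<^sup>*x\<close>, and it suffices that \<open>\<sigma>\<delta>\<sigma>' = \<sigma>\<close>. For every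
  section \<open>\<gamma>\<close> of \<open>\<sigma>\<close> one has \<open>(\<sigma>\<delta>\<sigma>'\<gamma>)\<^sup>*x = \<gamma>\<^sup>*y = x\<close>, hence \<open>\<sigma>\<delta>\<sigma>'\<gamma>\<close> is the identity because \<open>x\<close> is
  not degenerate; and each element of \<open>[M]\<close> lies in the image of some section \<open>\<gamma>\<close>.
\<close>

lemma presentations_agree:
  assumes p: "presents m \<sigma> x" and min: "\<And>m' \<sigma>' x'. presents m' \<sigma>' x' \<Longrightarrow> m \<le> m'"
    and p': "presents m' \<sigma>' x'" and \<rho>: "\<rho> \<in> delta_maps k M"
  shows "A k m' (delta_comp k \<sigma>' \<rho>) x' = A k m (delta_comp k \<sigma> \<rho>) x"
  using p'
proof (induction m' arbitrary: \<sigma>' x' rule: less_induct)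
  case (less m')
  show ?case
  proof (cases "{0..m'} \<subseteq> \<sigma>' ` {0..M}")
    case False
    then obtain j where j: "j \<le> m'" "j \<notin> \<sigma>' ` {0..M}" by (meson atLeastAtMost_iff subsetI)
    obtain \<sigma>'' x'' where d: "1 \<le> m'" "presents (m' - 1) \<sigma>'' x''"
      "\<forall>k. \<forall>\<rho>\<in>delta_maps k M. A k m' (delta_comp k \<sigma>' \<rho>) x' = A k (m' - 1) (delta_comp k \<sigma>'' \<rho>) x''"
      using presents_drop[OF less.prems j] by metis
    show ?thesis using less.IH[OF _ d(2)] d(1) bspec[OF spec[OF d(3)] \<rho>] by simp
  next
    case True
    have P: "m < M" "\<sigma> \<in> delta_maps M m" "x \<in> cells X m" "A M m \<sigma> x = y" using p by (auto simp: presents_def)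
    have P': "m' < M" "\<sigma>' \<in> delta_maps M m'" "x' \<in> cells X m'" "A M m' \<sigma>' x' = y"
      using less.prems by (auto simp: presents_def)
    have surj: "{0..m} \<subseteq> \<sigma> ` {0..M}" by (rule minimal_presentation_surj[OF p]) (rule min)
    have restr: "act X i M \<delta> y = x0"
      if "i < M" "\<gamma> \<in> delta_maps M i" "x0 \<in> cells X i" "A M i \<gamma> x0 = y"
        and d: "\<delta> \<in> delta_inj_maps i M" "delta_comp i \<gamma> \<delta> = delta_id i" for i \<gamma> x0 \<delta>
    proof -
      have "act X i M \<delta> y = A i i (delta_id i) x0"
        using partial_structure_act[OF A that(1,3,2) d(1)] that(4) d(2) by simp
      also have "\<dots> = x0"
        using partial_structure_inj[OF A that(1,3) delta_id_in] act_id[OF semi that(3)] by simp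
      finally show ?thesis .
    qed
    obtain \<delta> where \<delta>: "\<delta> \<in> delta_inj_maps m' M" "delta_comp m' \<sigma>' \<delta> = delta_id m'"
      using section_through[OF P'(2) True, of 0] by auto
    define \<pi> where "\<pi> = delta_comp m' \<sigma> \<delta>"
    have \<pi>: "\<pi> \<in> delta_maps m' m" unfolding \<pi>_def by (rule delta_comp_in[OF delta_inj_mapsD[OF \<delta>(1)] P(2)])
    have x': "x' = A m' m \<pi> x"
      using restr[OF P' \<delta>] partial_structure_act[OF A P(1,3,2) \<delta>(1)] P(4) by (simp add: \<pi>_def)
    have push: "A l m' \<tau> x' = A l m (delta_comp l \<pi> \<tau>) x" if "\<tau> \<in> delta_maps l m'" for l \<tau>
      using partial_structure_comp[OF A P(1,3) P'(1) \<pi> that] by (simp add: x')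
    have "delta_comp M \<pi> \<sigma>' = \<sigma>"
    proof (rule delta_maps_eqI[OF delta_comp_in[OF P'(2) \<pi>] P(2)])
      fix q assume q: "q \<le> M"
      obtain \<gamma> where \<gamma>: "\<gamma> \<in> delta_inj_maps m M" "delta_comp m \<sigma> \<gamma> = delta_id m" "\<gamma> (\<sigma> q) = q"
        using section_through[OF P(2) surj q] .
      let ?\<theta> = "delta_comp m (delta_comp M \<pi> \<sigma>') \<gamma>"
      have \<theta>: "?\<theta> \<in> delta_maps m m"
        by (rule delta_comp_in[OF delta_inj_mapsD[OF \<gamma>(1)] delta_comp_in[OF P'(2) \<pi>]])
      have "A m m ?\<theta> x = act X m M \<gamma> (A M m (delta_comp M \<pi> \<sigma>') x)"
        by (rule partial_structure_act[OF A P(1,3) delta_comp_in[OF P'(2) \<pi>] \<gamma>(1)])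
      also have "A M m (delta_comp M \<pi> \<sigma>') x = y" using push[OF P'(2)] P'(4) by simp
      also have "act X m M \<gamma> y = x" by (rule restr[OF P \<gamma>(1,2)])
      finally have fixed: "A m m ?\<theta> x = x" .
      have "?\<theta> = delta_id m"
        by (rule minimal_presentation_endo[OF p _ \<theta> fixed]) (rule min)
      then have "?\<theta> (\<sigma> q) = \<sigma> q" using delta_maps_le[OF P(2) q] by simp
      then show "delta_comp M \<pi> \<sigma>' q = \<sigma> q" using delta_maps_le[OF P(2) q] q \<gamma>(3) by simp
    qed
    moreover have "A k m' (delta_comp k \<sigma>' \<rho>) x' = A k m (delta_comp k (delta_comp M \<pi> \<sigma>') \<rho>) x"
      using push[OF delta_comp_in[OF \<rho> P'(2)]] by (simp add: delta_comp_assoc[OF \<rho>])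
    ultimately show ?thesis by simp
  qed
qed

text \<open>
  All values are forced by any presentation of \<open>y\<close>; one of minimal dimension is used, since
  \<open>presentations_agree\<close> compares the others with it.
\<close>

lemma cell_action_degenerate:
  assumes "presents m \<sigma> x"
  shows "\<exists>D. cell_action X s M A y D"
proof -
  define \<mu> where "\<mu> = (LEAST m. \<exists>\<sigma> x. presents m \<sigma> x)"
  have "\<exists>\<sigma> x. presents \<mu> \<sigma> x" unfolding \<mu>_def by (rule LeastI[of _ m]) (use assms in blast)
  then obtain \<sigma> x where p: "presents \<mu> \<sigma> x" by blast
  have min: "\<mu> \<le> m'" if "presents m' \<sigma>' x'" for m' \<sigma>' x'
    unfolding \<mu>_def by (rule Least_le) (use that in blast)
  have P: "\<mu> < M" "\<sigma> \<in> delta_maps M \<mu>" "x \<in> cells X \<mu>" "A M \<mu> \<sigma> x = y" using p by (auto simp: presents_def)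
  define D where "D k \<rho> = A k \<mu> (delta_comp k \<sigma> \<rho>) x" for k \<rho>
  have "D n \<tau> \<in> cells X n" if "\<tau> \<in> delta_maps n M" for n \<tau>
    unfolding D_def by (rule partial_structure_cells[OF A P(1,3) delta_comp_in[OF that P(2)]])
  moreover have "D M (delta_id M) = y" using P(2,4) by (simp add: D_def)
  moreover have "D k (delta_comp k \<tau> \<rho>) = act X k n \<rho> (D n \<tau>)"
    if "\<tau> \<in> delta_maps n M" "\<rho> \<in> delta_inj_maps k n" for n k \<tau> \<rho>
    unfolding D_def delta_comp_assoc[OF delta_inj_mapsD[OF that(2)]]
    by (rule partial_structure_act[OF A P(1,3) delta_comp_in[OF that(1) P(2)] that(2)])
  moreover have "D n (delta_comp n (coface M j) \<epsilon>) = A n (M - 1) \<epsilon> (face X M j y)"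
    if "1 \<le> M" "j \<le> M" "\<epsilon> \<in> delta_maps n (M - 1)" for j n \<epsilon>
  proof -
    have c: "coface M j \<in> delta_inj_maps (M - 1) M" using coface_in[OF that(1,2)] .
    have sc: "delta_comp (M - 1) \<sigma> (coface M j) \<in> delta_maps (M - 1) \<mu>"
      by (rule delta_comp_in[OF delta_inj_mapsD[OF c] P(2)])
    have "D n (delta_comp n (coface M j) \<epsilon>) = A n (M - 1) \<epsilon> (A (M - 1) \<mu> (delta_comp (M - 1) \<sigma> (coface M j)) x)"
      unfolding D_def delta_comp_assoc[OF that(3)]
      by (rule partial_structure_comp[OF A P(1,3) _ sc that(3)]) (use that(1) in simp)
    also have "A (M - 1) \<mu> (delta_comp (M - 1) \<sigma> (coface M j)) x = face X M j y"
      using partial_structure_act[OF A P(1,3,2) c] P(4) by (simp add: face_def)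
    finally show ?thesis .
  qed
  moreover have "D k \<rho> = A k m (delta_comp k \<sigma>' \<rho>) x'"
    if "m < M" "\<sigma>' \<in> delta_maps M m" "x' \<in> cells X m" "A M m \<sigma>' x' = y" and \<rho>: "\<rho> \<in> delta_maps k M"
    for m \<sigma>' x' k \<rho>
  proof -
    have "presents m \<sigma>' x'" using that by (simp add: presents_def)
    from presentations_agree[OF p _ this \<rho>] min show ?thesis by (simp add: D_def)
  qed
  ultimately have "cell_action X s M A y D" using P(1) unfolding cell_action_def by simp
  then show ?thesis by blast
qed

lemma cell_action_of_word_map:
  assumes F: "word_map X {w. w \<noteq> [] \<and> sorted w \<and> set w \<subseteq> {..M}} F"
  defines "D \<equiv> \<lambda>n \<tau>. F (word_of n \<tau>)"
  shows "\<tau> \<in> delta_maps n M \<Longrightarrow> D n \<tau> \<in> cells X n"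
    and "\<tau> \<in> delta_maps n M \<Longrightarrow> \<rho> \<in> delta_inj_maps k n \<Longrightarrow> D k (delta_comp k \<tau> \<rho>) = act X k n \<rho> (D n \<tau>)"
proof -
  assume "\<tau> \<in> delta_maps n M"
  then have w: "word_of n \<tau> \<in> {w. w \<noteq> [] \<and> sorted w \<and> set w \<subseteq> {..M}}" using word_of_props by simp
  show "D n \<tau> \<in> cells X n" unfolding D_def by (rule word_map_cells[OF F w length_word_of])
  assume "\<rho> \<in> delta_inj_maps k n"
  then show "D k (delta_comp k \<tau> \<rho>) = act X k n \<rho> (D n \<tau>)"
    unfolding D_def by (rule word_map_act_word_of[OF semi face_closed_words F w, symmetric])
qed

lemma cell_action_vertex:
  assumes M: "M = 0" and eqv: "equivalence X (s y)" and idem: "idempotent_at X y (s y)"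
  shows "\<exists>D. cell_action X s M A y D"
proof -
  obtain F where F: "word_map X {w. w \<noteq> [] \<and> set w \<subseteq> {0::nat}} F" and F0: "F [0] = y" "F [0, 0] = s y"
    using extend_over_vertex[OF X eqv idem] by blast
  have "{w. w \<noteq> [] \<and> sorted w \<and> set w \<subseteq> {..M}} = {w. w \<noteq> [] \<and> set w \<subseteq> {0::nat}}"
  proof -
    have "sorted w" if "set w \<subseteq> {0::nat}" for w using that by (induction w) auto
    then show ?thesis unfolding M by auto
  qed
  with F have "word_map X {w. w \<noteq> [] \<and> sorted w \<and> set w \<subseteq> {..M}} F" by simp
  note D = cell_action_of_word_map[OF this]
  have "word_of M (delta_id M) = [0]" "word_of 1 (codegeneracy 0 0) = [0, 0]"
    by (simp_all add: word_of_def M codegeneracy_def)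
  then have "cell_action X s M A y (\<lambda>n \<tau>. F (word_of n \<tau>))"
    unfolding cell_action_def using D F0 M by simp
  then show ?thesis by blast
qed

text \<open>
  On words that miss a letter the partial structure dictates the values. The constant words \<open>ii\<close> are
  among them because \<open>M \<ge> 1\<close>, and their values are the prescribed equivalences at the vertices of \<open>y\<close>.
\<close>

lemma cell_action_nondegenerate:
  assumes M: "1 \<le> M" and nondeg: "\<And>m \<sigma> x. \<not> presents m \<sigma> x"
    and eqv: "\<And>x. x \<in> cells X 0 \<Longrightarrow> equivalence X (s x)"
  shows "\<exists>D. cell_action X s M A y D"
proof -
  define N where "N = {w. w \<noteq> [] \<and> sorted w \<and> set w \<subset> {..M}}"
  define z where "z j = face X M j y" for j
  have z: "z j \<in> cells X (M - 1)" if "j \<le> M" for j unfolding z_def using face_in_cells[OF semi M that y] .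
  have M1: "M - 1 < M" using M by simp
  define lifts where "lifts n w j \<epsilon> \<longleftrightarrow> j \<le> M \<and> \<epsilon> \<in> delta_maps n (M - 1) \<and> w = word_of n (delta_comp n (coface M j) \<epsilon>)"
    for n w j \<epsilon>
  \<comment> \<open>The forced values; by \<open>lower_faces_agree\<close> they do not depend on the face \<open>j\<close>.\<close>
  define B where "B w = (SOME b. \<exists>n j \<epsilon>. lifts n w j \<epsilon> \<and> b = A n (M - 1) \<epsilon> (z j))" for w
  have B: "B w = A n (M - 1) \<epsilon> (z j)" if l: "lifts n w j \<epsilon>" for n w j \<epsilon>
    unfolding B_def
  proof (rule some_equality)
    show "\<exists>n' j' \<epsilon>'. lifts n' w j' \<epsilon>' \<and> A n (M - 1) \<epsilon> (z j) = A n' (M - 1) \<epsilon>' (z j')" using l by blast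
    fix b assume "\<exists>n' j' \<epsilon>'. lifts n' w j' \<epsilon>' \<and> b = A n' (M - 1) \<epsilon>' (z j')"
    then obtain n' j' \<epsilon>' where l': "lifts n' w j' \<epsilon>'" and b: "b = A n' (M - 1) \<epsilon>' (z j')" by blast
    have len: "length w = Suc k" if "lifts k w i \<eta>" for k i \<eta> using that unfolding lifts_def by simp
    have n: "n' = n" using len[OF l] len[OF l'] by simp
    have j: "j \<le> M" "j' \<le> M" and \<epsilon>: "\<epsilon> \<in> delta_maps n (M - 1)" "\<epsilon>' \<in> delta_maps n (M - 1)"
      using l l' by (simp_all add: lifts_def n)
    have "delta_comp n (coface M j) \<epsilon> = delta_comp n (coface M j') \<epsilon>'"
      by (rule word_of_inject[OF delta_comp_in[OF \<epsilon>(1) coface_in_maps[OF M j(1)]]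
            delta_comp_in[OF \<epsilon>(2) coface_in_maps[OF M j(2)]]])
        (use l l' in \<open>simp add: lifts_def n\<close>)
    from lower_faces_agree[OF M \<epsilon> j this] show "b = A n (M - 1) \<epsilon> (z j)" by (simp add: b n z_def)
  qed
  have lift: "\<exists>j \<epsilon>. lifts (length w - 1) w j \<epsilon>" if wN: "w \<in> N" for w
  proof -
    have "w \<noteq> []" "sorted w" "set w \<subseteq> {..M}" using wN by (auto simp: N_def)
    then obtain \<tau> where \<tau>: "\<tau> \<in> delta_maps (length w - 1) M" and w: "word_of (length w - 1) \<tau> = w"
      by (rule word_of_surj)
    obtain j where j: "j \<le> M" "j \<notin> set w" using wN unfolding N_def by blast
    have "j \<notin> \<tau> ` {0..length w - 1}" using j(2) word_of_props(3)[OF \<tau>] unfolding w by blast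
    from factor_through_coface[OF \<tau> j(1) this] obtain \<epsilon> where
      \<epsilon>: "\<epsilon> \<in> delta_maps (length w - 1) (M - 1)" "\<tau> = delta_comp (length w - 1) (coface M j) \<epsilon>" .
    have "lifts (length w - 1) w j \<epsilon>" using \<epsilon>(1) j(1) w[symmetric] unfolding lifts_def \<epsilon>(2) by simp
    then show ?thesis by blast
  qed
  have lift_in_N: "w \<in> N" if "lifts n w j \<epsilon>" for n w j \<epsilon>
  proof -
    have j: "j \<le> M" and \<epsilon>: "\<epsilon> \<in> delta_maps n (M - 1)" and w: "w = word_of n (delta_comp n (coface M j) \<epsilon>)"
      using that by (simp_all add: lifts_def)
    note p = word_of_props[OF delta_comp_in[OF \<epsilon> coface_in_maps[OF M j]], folded w]
    have "j \<notin> set w" unfolding p(3)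
      using delta_maps_le[OF \<epsilon>] by (auto simp: coface_apply split: if_splits)
    with p(4) j have "set w \<subset> {..M}" by blast
    with p(1,2) show ?thesis unfolding N_def by simp
  qed
  have B_word_map: "word_map X N B"
    unfolding word_map_def
  proof (intro ballI conjI impI allI)
    fix w assume "w \<in> N"
    then obtain j \<epsilon> where l: "lifts (length w - 1) w j \<epsilon>" using lift by blast
    define n where "n = length w - 1"
    have j: "j \<le> M" and \<epsilon>: "\<epsilon> \<in> delta_maps n (M - 1)" and w: "w = word_of n (delta_comp n (coface M j) \<epsilon>)"
      using l by (simp_all add: lifts_def n_def)
    show "B w \<in> cells X (length w - 1)"
      unfolding B[OF l] n_def[symmetric] by (rule partial_structure_cells[OF A M1 z[OF j] \<epsilon>])
    fix i assume i: "2 \<le> length w" "i < length w"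
    then have n: "1 \<le> n" "i \<le> n" by (auto simp: n_def)
    have c: "coface n i \<in> delta_inj_maps (n - 1) n" using coface_in[OF n] .
    have "omit i w = word_of (n - 1) (delta_comp (n - 1) (coface M j) (delta_comp (n - 1) \<epsilon> (coface n i)))"
      unfolding delta_comp_assoc[OF delta_inj_mapsD[OF c]] w word_of_comp_coface[OF n] ..
    then have "lifts (n - 1) (omit i w) j (delta_comp (n - 1) \<epsilon> (coface n i))"
      unfolding lifts_def using j delta_comp_in[OF delta_inj_mapsD[OF c] \<epsilon>] by blast
    from B[OF this] show "face X (length w - 1) i (B w) = B (omit i w)"
      using partial_structure_act[OF A M1 z[OF j] \<epsilon> c] unfolding B[OF l] n_def[symmetric] face_def by simp
  qed
  have id: "delta_id (M - 1) \<in> delta_inj_maps (M - 1) (M - 1)" by (rule delta_id_in)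
  have y_faces: "face X M i y = B (omit i [0..<Suc M])" if i: "i \<le> M" for i
  proof -
    have c: "coface M i \<in> delta_inj_maps (M - 1) M" using coface_in[OF M i] .
    have "[0..<Suc M] = word_of M (delta_id M)"
      by (intro nth_equalityI) (simp_all add: word_of_def del: upt_Suc)
    then have "omit i [0..<Suc M] = word_of (M - 1) (delta_comp (M - 1) (delta_id M) (coface M i))"
      using word_of_comp_coface[OF M i] by simp
    then have "lifts (M - 1) (omit i [0..<Suc M]) i (delta_id (M - 1))"
      using i delta_inj_mapsD[OF id] delta_comp_id_left[OF delta_inj_mapsD[OF c]]
        delta_comp_id_right[OF delta_inj_mapsD[OF c]] by (simp only: lifts_def)
    from B[OF this] show ?thesis
      using partial_structure_inj[OF A M1 z[OF i] id] act_id[OF semi z[OF i]] by (simp add: z_def)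
  qed
  have unit: "equivalence X (B [i, i])" if i: "i \<le> M" for i
  proof -
    have "[i, i] \<in> N" using i M by (cases "i = 0") (auto simp: N_def)
    then obtain j \<epsilon> where l: "lifts 1 [i, i] j \<epsilon>" using lift[of "[i, i]"] by auto
    then have j: "j \<le> M" and \<epsilon>: "\<epsilon> \<in> delta_maps 1 (M - 1)" and w: "[i, i] = word_of 1 (delta_comp 1 (coface M j) \<epsilon>)"
      by (simp_all add: lifts_def)
    define \<mu> where "\<mu> = restrict (\<lambda>_. \<epsilon> 0) {0..0::nat}"
    have \<mu>: "\<mu> \<in> delta_maps 0 (M - 1)"
      unfolding \<mu>_def by (rule restrict_in_delta_maps) (use delta_maps_le[OF \<epsilon>] in auto)
    have cd: "codegeneracy 0 0 \<in> delta_maps 1 0"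
      unfolding codegeneracy_def by (simp, rule restrict_in_delta_maps) auto
    have "coface M j (\<epsilon> 0) = coface M j (\<epsilon> 1)" using w by (simp add: word_of_def)
    then have "\<epsilon> 0 = \<epsilon> 1"
      using delta_inj_maps_eq_iff[OF coface_in[OF M j]] delta_maps_le[OF \<epsilon>] by simp
    then have "\<epsilon> i = delta_comp 1 \<mu> (codegeneracy 0 0) i" if "i \<le> 1" for i
      using that by (cases i) (simp_all add: \<mu>_def codegeneracy_def)
    then have "\<epsilon> = delta_comp 1 \<mu> (codegeneracy 0 0)" by (rule delta_maps_eqI[OF \<epsilon> delta_comp_in[OF cd \<mu>]])
    then have "B [i, i] = A 1 0 (codegeneracy 0 0) (A 0 (M - 1) \<mu> (z j))"
      using partial_structure_comp[OF A M1 z[OF j] _ \<mu> cd] M B[OF l] by simp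
    also have "\<dots> = s (A 0 (M - 1) \<mu> (z j))"
      using partial_structure_unit[OF A] partial_structure_cells[OF A M1 z[OF j] \<mu>] M by simp
    finally show ?thesis using eqv[OF partial_structure_cells[OF A M1 z[OF j] \<mu>]] by simp
  qed
  obtain F where F: "word_map X {w. w \<noteq> [] \<and> sorted w \<and> set w \<subseteq> {..M}} F"
    and FB: "\<And>w. w \<in> N \<Longrightarrow> F w = B w" and Fy: "F [0..<Suc M] = y"
    using extend_over_simplex[OF X M N_def B_word_map y y_faces unit] by blast
  note D = cell_action_of_word_map[OF F]
  have "F (word_of M (delta_id M)) = y"
  proof -
    have "word_of M (delta_id M) = [0..<Suc M]"
      by (intro nth_equalityI) (simp_all add: word_of_def del: upt_Suc)
    then show ?thesis using Fy by simp
  qed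
  moreover have "F (word_of n (delta_comp n (coface M j) \<epsilon>)) = A n (M - 1) \<epsilon> (face X M j y)"
    if "j \<le> M" "\<epsilon> \<in> delta_maps n (M - 1)" for j n \<epsilon>
  proof -
    have l: "lifts n (word_of n (delta_comp n (coface M j) \<epsilon>)) j \<epsilon>" using that by (simp add: lifts_def)
    show ?thesis using FB[OF lift_in_N[OF l]] B[OF l] by (simp add: z_def)
  qed
  moreover have "A M m \<sigma> x \<noteq> y" if "m < M" "\<sigma> \<in> delta_maps M m" "x \<in> cells X m" for m \<sigma> x
    using nondeg[of m \<sigma> x] that by (simp add: presents_def)
  ultimately have "cell_action X s M A y (\<lambda>n \<tau>. F (word_of n \<tau>))"
    unfolding cell_action_def using D M by simp
  then show ?thesis by blast
qed

lemma cell_action_exists: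
  assumes "\<And>x. x \<in> cells X 0 \<Longrightarrow> idempotent_at X x (s x) \<and> equivalence X (s x)"
  shows "\<exists>D. cell_action X s M A y D"
proof (cases "M = 0")
  case True
  with y assms show ?thesis by (intro cell_action_vertex) auto
next
  case False
  show ?thesis
  proof (cases "\<exists>m \<sigma> x. presents m \<sigma> x")
    case True then show ?thesis using cell_action_degenerate by blast
  next
    case f: False
    show ?thesis by (rule cell_action_nondegenerate) (use f False assms in auto)
  qed
qed

end

lemma cell_actionD:
  assumes "cell_action X s M A y D"
  shows cell_action_cells: "\<And>n \<tau>. \<tau> \<in> delta_maps n M \<Longrightarrow> D n \<tau> \<in> cells X n"
    and cell_action_id: "D M (delta_id M) = y"
    and cell_action_act: "\<And>n k \<tau> \<rho>. \<tau> \<in> delta_maps n M \<Longrightarrow> \<rho> \<in> delta_inj_maps k n \<Longrightarrow>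
      D k (delta_comp k \<tau> \<rho>) = act X k n \<rho> (D n \<tau>)"
    and cell_action_face: "\<And>j n \<epsilon>. 1 \<le> M \<Longrightarrow> j \<le> M \<Longrightarrow> \<epsilon> \<in> delta_maps n (M - 1) \<Longrightarrow>
      D n (delta_comp n (coface M j) \<epsilon>) = A n (M - 1) \<epsilon> (face X M j y)"
    and cell_action_presented: "\<And>m \<sigma> x k \<rho>. m < M \<Longrightarrow> \<sigma> \<in> delta_maps M m \<Longrightarrow> x \<in> cells X m \<Longrightarrow>
      A M m \<sigma> x = y \<Longrightarrow> \<rho> \<in> delta_maps k M \<Longrightarrow> D k \<rho> = A k m (delta_comp k \<sigma> \<rho>) x"
    and cell_action_unit: "M = 0 \<Longrightarrow> D 1 (codegeneracy 0 0) = s y"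
  using assms unfolding cell_action_def by simp_all

section \<open>The simplicial structure\<close>

text \<open>
  The pullbacks of the single \<open>M\<close>-cells can be chosen independently of each other. Only composites whose
  intermediate cell has dimension \<open>M\<close> relate them, and there \<open>\<tau>\<close> is the identity or the intermediate
  cell is a pullback of a lower cell, a case covered by the definition of \<open>cell_action\<close>.
\<close>

lemma partial_structure_Suc:
  assumes X: "quasi_semicategory X" and A: "partial_structure X s M A"
    and s: "\<And>x. x \<in> cells X 0 \<Longrightarrow> idempotent_at X x (s x) \<and> equivalence X (s x)"
  shows "\<exists>A'. partial_structure X s (Suc M) A' \<and> (\<forall>m<M. \<forall>n. A' n m = A n m)"
proof -
  have S: "semisimplicial_set X" using X by (simp add: quasi_semicategory_def)
  have "\<forall>y\<in>cells X M. \<exists>D. cell_action X s M A y D" using cell_action_exists[OF X A _ s] by blast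
  then obtain D where D: "\<And>y. y \<in> cells X M \<Longrightarrow> cell_action X s M A y (D y)" by metis
  define A' where "A' n m \<tau> x = (if m = M then D x n \<tau> else A n m \<tau> x)" for n m \<tau> x
  have top: "A' n M \<tau> x = D x n \<tau>" for n \<tau> x by (simp add: A'_def)
  have low: "A' n m \<tau> x = A n m \<tau> x" if "m < M" for n m \<tau> x using that by (simp add: A'_def)
  have cells: "A' n m \<tau> x \<in> cells X n" if "m < Suc M" "\<tau> \<in> delta_maps n m" "x \<in> cells X m" for n m \<tau> x
  proof (cases "m = M")
    case True then show ?thesis using cell_action_cells[OF D] that by (simp add: top)
  next
    case False
    then show ?thesis using partial_structure_cells[OF A _ that(3,2)] that(1) by (simp add: low)
  qed
  have inj_act: "A' k m (delta_comp k \<tau> \<rho>) x = act X k n \<rho> (A' n m \<tau> x)"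
    if "m < Suc M" "\<tau> \<in> delta_maps n m" "\<rho> \<in> delta_inj_maps k n" "x \<in> cells X m" for k n m \<tau> \<rho> x
  proof (cases "m = M")
    case True then show ?thesis using cell_action_act[OF D] that by (simp add: top)
  next
    case False
    then show ?thesis using partial_structure_act[OF A _ that(4,2,3)] that(1) by (simp add: low)
  qed
  have inj: "A' n m \<tau> x = act X n m \<tau> x"
    if "m < Suc M" "\<tau> \<in> delta_inj_maps n m" "x \<in> cells X m" for n m \<tau> x
  proof (cases "m = M")
    case True
    have x: "x \<in> cells X M" using that True by simp
    have "D x n (delta_comp n (delta_id M) \<tau>) = act X n M \<tau> (D x M (delta_id M))"
      using cell_action_act[OF D[OF x] delta_inj_mapsD[OF delta_id_in]] that True by simp
    then show ?thesis
      using that True cell_action_id[OF D[OF x]] by (simp add: top delta_inj_mapsD)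
  next
    case False
    then show ?thesis using partial_structure_inj[OF A _ that(3,2)] that(1) by (simp add: low)
  qed
  have comp: "A' k m (delta_comp k \<tau> \<rho>) x = A' k n \<rho> (A' n m \<tau> x)"
    if m: "m < Suc M" and n: "n < Suc M" and \<tau>: "\<tau> \<in> delta_maps n m" and \<rho>: "\<rho> \<in> delta_maps k n"
      and x: "x \<in> cells X m" for k m n \<tau> \<rho> x
  proof -
    \<comment> \<open>For \<open>n = M\<close> the intermediate cell is degenerate, and its pullbacks were chosen accordingly.\<close>
    have low_comp: "A k l (delta_comp k \<sigma> \<rho>) z = A' k n \<rho> (A n l \<sigma> z)"
      if l: "l < M" and \<sigma>: "\<sigma> \<in> delta_maps n l" and z: "z \<in> cells X l" for l \<sigma> z
    proof (cases "n = M")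
      case True
      have \<sigma>': "\<sigma> \<in> delta_maps M l" and \<rho>': "\<rho> \<in> delta_maps k M" using \<sigma> \<rho> True by simp_all
      show ?thesis unfolding True top
        by (rule cell_action_presented[OF D[OF partial_structure_cells[OF A l z \<sigma>']] l \<sigma>' z refl \<rho>', symmetric])
    next
      case False
      then have "n < M" using n by simp
      then show ?thesis using partial_structure_comp[OF A l z _ \<sigma> \<rho>] by (simp add: low)
    qed
    show ?thesis
    proof (cases "m = M")
      case False
      then have "m < M" using m by simp
      then show ?thesis using low_comp[OF _ \<tau> x] by (simp add: low)
    next
      case True
      have x': "x \<in> cells X M" and \<tau>': "\<tau> \<in> delta_maps n M" using x \<tau> True by simp_all
      show ?thesis
      proof (cases "{0..M} \<subseteq> \<tau> ` {0..n}")
        case surj: True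
        have "card {0..M} \<le> card (\<tau> ` {0..n})" by (rule card_mono) (use surj in auto)
        also have "\<dots> \<le> card {0..n}" by (rule card_image_le) simp
        finally have "n = M" using n by simp
        with \<tau>' surj have "\<tau> = delta_id M" by (intro delta_surj_endo) simp_all
        then show ?thesis using True \<open>n = M\<close> \<rho> cell_action_id[OF D[OF x']] by (simp add: top)
      next
        case False
        then obtain j where j: "j \<le> M" "j \<notin> \<tau> ` {0..n}" by (meson atLeastAtMost_iff subsetI)
        obtain \<epsilon> where M: "1 \<le> M" and \<epsilon>: "\<epsilon> \<in> delta_maps n (M - 1)"
          and e: "\<tau> = delta_comp n (coface M j) \<epsilon>" using factor_through_coface[OF \<tau>' j] .
        have z: "face X M j x \<in> cells X (M - 1)" by (rule face_in_cells[OF S M j(1) x'])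
        have "delta_comp k \<tau> \<rho> = delta_comp k (coface M j) (delta_comp k \<epsilon> \<rho>)"
          unfolding e by (rule delta_comp_assoc[OF \<rho>, symmetric])
        then have "A' k m (delta_comp k \<tau> \<rho>) x = A k (M - 1) (delta_comp k \<epsilon> \<rho>) (face X M j x)"
          using cell_action_face[OF D[OF x'] M j(1) delta_comp_in[OF \<rho> \<epsilon>]] by (simp add: True top)
        also have "\<dots> = A' k n \<rho> (A n (M - 1) \<epsilon> (face X M j x))"
          using M by (intro low_comp \<epsilon> z) simp
        also have "A n (M - 1) \<epsilon> (face X M j x) = A' n m \<tau> x"
          using cell_action_face[OF D[OF x'] M j(1) \<epsilon>] by (simp add: True top e)
        finally show ?thesis .
      qed
    qed
  qed
  have unit: "A' 1 0 (codegeneracy 0 0) x = s x" if "x \<in> cells X 0" for x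
  proof (cases "M = 0")
    case True then show ?thesis using cell_action_unit[OF D] that by (simp add: A'_def)
  next
    case False then show ?thesis using partial_structure_unit[OF A _ that] by (simp add: low)
  qed
  have "partial_structure X s (Suc M) A'"
    unfolding partial_structure_def using cells inj comp inj_act unit by simp
  moreover have "\<forall>m<M. \<forall>n. A' n m = A n m" using low by blast
  ultimately show ?thesis by blast
qed

theorem theorem1p2:
  fixes X :: "'a presheaf" and s\<^sub>0 :: "'a \<Rightarrow> 'a"
  assumes "quasi_semicategory X"
    and "\<forall>x\<in>cells X 0. idempotent_at X x (s\<^sub>0 x) \<and> equivalence X (s\<^sub>0 x)"
  shows "\<exists>Y. simplicial_structure_on X Y \<and> (\<forall>x\<in>cells X 0. degeneracy Y 0 0 x = s\<^sub>0 x)"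
proof -
  have S: "semisimplicial_set X" using assms(1) by (simp add: quasi_semicategory_def)
  have "partial_structure X s\<^sub>0 0 A" for A by (simp add: partial_structure_def)
  then obtain G where G: "\<And>M. partial_structure X s\<^sub>0 M (G M)"
    and stable: "\<And>M m n. m < M \<Longrightarrow> G (Suc M) n m = G M n m"
    using dependent_nat_choice[of "partial_structure X s\<^sub>0" "\<lambda>M A A'. \<forall>m<M. \<forall>n. A' n m = A n m"]
      partial_structure_Suc[OF assms(1)] assms(2) by metis
  \<comment> \<open>The pullbacks of \<open>m\<close>-cells are final from stage \<open>m + 1\<close> on.\<close>
  define A where "A n m = G (Suc m) n m" for n m
  have A: "A n m = G M n m" if "m < M" for n m M
    using that
  proof (induction M)
    case (Suc M)
    then show ?case using stable[of m M n] by (cases "m = M") (auto simp: A_def)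
  qed simp
  define Y where "Y = \<lparr>cells = cells X, act = A\<rparr>"
  have Y: "cells Y = cells X" "act Y = A" by (simp_all add: Y_def)
  have inj: "A n m \<tau> x = act X n m \<tau> x" if "\<tau> \<in> delta_inj_maps n m" "x \<in> cells X m" for n m \<tau> x
    unfolding A_def by (rule partial_structure_inj[OF G _ that(2,1)]) simp
  have "A k n (delta_comp k \<beta> \<alpha>) x = A k m \<alpha> (A m n \<beta> x)"
    if "\<alpha> \<in> delta_maps k m" "\<beta> \<in> delta_maps m n" "x \<in> cells X n" for k m n \<alpha> \<beta> x
  proof -
    define M where "M = Suc (max m n)"
    have M: "m < M" "n < M" by (simp_all add: M_def)
    show ?thesis unfolding A[OF M(1)] A[OF M(2)] by (rule partial_structure_comp[OF G M(2) that(3) M(1) that(2,1)])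
  qed
  moreover have "A m n \<alpha> x \<in> cells X m" if "\<alpha> \<in> delta_maps m n" "x \<in> cells X n" for m n \<alpha> x
    unfolding A_def by (rule partial_structure_cells[OF G _ that(2,1)]) simp
  moreover have "A n n (delta_id n) x = x" if "x \<in> cells X n" for n x
    using inj[OF delta_id_in that] act_id[OF S that] by simp
  ultimately have "simplicial_structure_on X Y"
    using inj unfolding simplicial_structure_on_def simplicial_set_def presheaf_on_def Y by simp
  moreover have "degeneracy Y 0 0 x = s\<^sub>0 x" if "x \<in> cells X 0" for x
    using partial_structure_unit[OF G[of 1] _ that] by (simp add: degeneracy_def Y A_def)
  ultimately show ?thesis by blast
qed

end
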